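(* Let $n,M\ge1$ be integers with $n\ge2M$, let $X_1,\dots,X_n$ be i.i.d. in a measurable space $\mathcal{Z}$, let $h:\mathcal{Z}\times\mathcal{Z}\to\mathbb{R}$ be a symmetric measurable kernel with $\mathbb{E}[h(X_1,X_2)^2]<\infty$, put $\theta(h)=\mathbb{E}[h(X_1,X_2)]$, and let $\varepsilon>0$. Let $\Lambda_n=\{(i,j):1\le i<j\le n\}$ and $$\widehat W_n^\varepsilon=\frac{1}{|\Lambda_n^M|}\sum_{\mathbf{J}\in\Lambda_n^M}\mathbf{1}\left\{\left|\widehat U_{M,\mathbf{J}}(h)-\theta(h)\right|\ge\varepsilon\right\},\qquad \widehat U_{M,\mathbf{J}}(h)=\frac1M\sum_{(i,j)\in\mathbf{J}}h(X_i,X_j),$$ and let $\widehat q_\varepsilon=\mathbb{E}[\widehat W_n^\varepsilon]$. Then for all $t>0$, $$\mathbb{P}\left(\widehat W_n^\varepsilon-\widehat q_\varepsilon\ge t\right)\le\exp\left(-\frac{nt^2}{8M\left(\sigma_*^2+\frac t3\right)}\right),$$ where $\sigma_*^2=\frac{1}{M\varepsilon^2}\left[2\sigma^2(h)+2\sigma_1^2(h)\right]\le\frac{3\sigma^2(h)}{M\varepsilon^2}$.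
   Context: $\Lambda_n^M$ is the $M$-fold Cartesian power of $\Lambda_n$, i.e. the set of all length-$M$ sequences $\mathbf{J}$ of pairs from $\Lambda_n$, with repetitions allowed; $\sum_{(i,j)\in\mathbf{J}}$ runs over the $M$ entries of the sequence, counted with multiplicity. Variances: $\sigma^2(h)=\mathrm{Var}(h(X_1,X_2))$, $\sigma_1^2(h)=\mathrm{Var}(\mathbb{E}[h(X_1,X_2)\mid X_1])$. *)

theory Defs
  imports "HOL-Probability.Probability"
begin

definition index_pairs :: "nat \<Rightarrow> (nat \<times> nat) set" where
  "index_pairs n = {(i, j). 1 \<le> i \<and> i < j \<and> j \<le> n}"

definition pair_seqs :: "nat \<Rightarrow> nat \<Rightarrow> (nat \<times> nat) list set" where
  "pair_seqs n M = {J. length J = M \<and> set J \<subseteq> index_pairs n}"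

definition incomplete_U ::
  "nat \<Rightarrow> (nat \<Rightarrow> 'a \<Rightarrow> 'z) \<Rightarrow> ('z \<times> 'z \<Rightarrow> real) \<Rightarrow> (nat \<times> nat) list \<Rightarrow> 'a \<Rightarrow> real" where
  "incomplete_U M X h J \<omega> = (1 / real M) * (\<Sum>(i, j)\<leftarrow>J. h (X i \<omega>, X j \<omega>))"

context prob_space
begin

definition iid_vars :: "'b measure \<Rightarrow> (nat \<Rightarrow> 'a \<Rightarrow> 'b) \<Rightarrow> nat \<Rightarrow> bool" where
  "iid_vars Z X n \<longleftrightarrow> indep_vars (\<lambda>_. Z) X {1..n} \<and>
     (\<forall>i\<in>{1..n}. \<forall>j\<in>{1..n}. distr M Z (X i) = distr M Z (X j))"

definition kernel_mean :: "(nat \<Rightarrow> 'a \<Rightarrow> 'b) \<Rightarrow> ('b \<times> 'b \<Rightarrow> real) \<Rightarrow> real" where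
  "kernel_mean X h = expectation (\<lambda>\<omega>. h (X 1 \<omega>, X 2 \<omega>))"

definition kernel_var :: "(nat \<Rightarrow> 'a \<Rightarrow> 'b) \<Rightarrow> ('b \<times> 'b \<Rightarrow> real) \<Rightarrow> real" where
  "kernel_var X h = variance (\<lambda>\<omega>. h (X 1 \<omega>, X 2 \<omega>))"

text \<open>Conditioning on \<open>X 1\<close> means conditioning on the sigma-algebra that it generates.\<close>

definition kernel_var1 ::
  "'b measure \<Rightarrow> (nat \<Rightarrow> 'a \<Rightarrow> 'b) \<Rightarrow> ('b \<times> 'b \<Rightarrow> real) \<Rightarrow> real" where
  "kernel_var1 Z X h = variance
     (real_cond_exp M (vimage_algebra (space M) (X 1) Z) (\<lambda>\<omega>. h (X 1 \<omega>, X 2 \<omega>)))"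

definition deviation_freq ::
  "nat \<Rightarrow> nat \<Rightarrow> (nat \<Rightarrow> 'a \<Rightarrow> 'b) \<Rightarrow> ('b \<times> 'b \<Rightarrow> real) \<Rightarrow> real \<Rightarrow> 'a \<Rightarrow> real" where
  "deviation_freq n m X h \<epsilon> \<omega> = (1 / real (card (pair_seqs n m))) *
     (\<Sum>J\<in>pair_seqs n m. of_bool (\<bar>incomplete_U m X h J \<omega> - kernel_mean X h\<bar> \<ge> \<epsilon>))"

definition deviation_mean ::
  "nat \<Rightarrow> nat \<Rightarrow> (nat \<Rightarrow> 'a \<Rightarrow> 'b) \<Rightarrow> ('b \<times> 'b \<Rightarrow> real) \<Rightarrow> real \<Rightarrow> real" where
  "deviation_mean n m X h \<epsilon> = expectation (deviation_freq n m X h \<epsilon>)"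

definition sigma_star_sq ::
  "nat \<Rightarrow> 'b measure \<Rightarrow> (nat \<Rightarrow> 'a \<Rightarrow> 'b) \<Rightarrow> ('b \<times> 'b \<Rightarrow> real) \<Rightarrow> real \<Rightarrow> real" where
  "sigma_star_sq m Z X h \<epsilon> =
     (1 / (real m * \<epsilon>\<^sup>2)) * (2 * kernel_var X h + 2 * kernel_var1 Z X h)"

end

end

theory Submission
  imports Defs
begin

text \<open>
  Write \<open>W\<close> for the deviation frequency and \<open>q\<close> for its mean. Following Hoeffding, \<open>W\<close> is an average
  over the permutations of the sample of means of \<open>k = \<lfloor>n / 2M\<rfloor>\<close> independent variables with values in
  \<open>[0, 1]\<close> and mean \<open>q\<close>. Convexity of \<open>exp\<close> and \<open>exp (\<lambda> y) \<le> 1 + y (exp \<lambda> - 1)\<close> on \<open>[0, 1]\<close> give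
  \<open>E (exp (\<lambda> k W)) \<le> exp (k q (exp \<lambda> - 1))\<close>, and Markov's inequality yields a Bernstein bound with
  variance proxy \<open>q\<close>; moreover \<open>k \<ge> n / 4M\<close>. By Chebyshev, \<open>q\<close> is at most \<open>\<epsilon>\<^sup>-\<^sup>2\<close> times the average of
  \<open>Var (U J)\<close> over \<open>J\<close>, whose off-diagonal part is the variance of the complete U-statistic; since
  \<open>n \<ge> 2M\<close> this is at most \<open>\<sigma>\<^sub>*\<^sup>2\<close>. The bound \<open>2 \<sigma>\<^sub>1\<^sup>2 \<le> \<sigma>\<^sup>2\<close> is nonnegativity of the second moment of the
  degenerate part \<open>g (x, y) - g\<^sub>1 x - g\<^sub>1 y\<close> of the centred kernel \<open>g\<close>.
\<close>

subsection \<open>Elementary facts\<close>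

text \<open>The Taylor series of \<open>exp\<close> beyond the linear term is compared term by term
  with a geometric series of ratio \<open>l / 3\<close>, since each factor of
  \<open>fact (k + 2)\<close> after the first two is at least 3.\<close>

lemma exp_minus_linear_le:
  fixes l :: real
  assumes "0 \<le> l" "l < 3"
  shows "exp l - 1 - l \<le> l\<^sup>2 / (2 * (1 - l / 3))"
proof -
  have fact_ge: "2 * 3 ^ k \<le> (fact (k + 2) :: real)" for k
  proof (induction k)
    case (Suc k)
    have "2 * 3 ^ Suc k = 3 * (2 * 3 ^ k :: real)" by simp
    also have "\<dots> \<le> (real k + 3) * fact (k + 2)"
      by (intro mult_mono Suc) auto
    also have "\<dots> = fact (Suc k + 2)" by (simp add: algebra_simps)
    finally show ?case .
  qed simp
  have geo: "(\<lambda>k. (l\<^sup>2 / 2) * (l / 3) ^ k) sums ((l\<^sup>2 / 2) * (1 / (1 - l / 3)))"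
    by (intro sums_mult geometric_sums) (use assms in auto)
  have "(\<Sum>k. inverse (fact (k + 2)) *\<^sub>R l ^ (k + 2)) \<le> (\<Sum>k. (l\<^sup>2 / 2) * (l / 3) ^ k)"
  proof (rule suminf_le)
    fix k
    have "inverse (fact (k + 2)) * l ^ (k + 2) \<le> inverse (2 * 3 ^ k) * l ^ (k + 2)"
      by (intro mult_right_mono le_imp_inverse_le fact_ge) (use assms in auto)
    also have "\<dots> = (l\<^sup>2 / 2) * (l / 3) ^ k"
      by (simp add: field_simps power2_eq_square)
    finally show "inverse (fact (k + 2)) *\<^sub>R l ^ (k + 2) \<le> (l\<^sup>2 / 2) * (l / 3) ^ k" by simp
  next
    show "summable (\<lambda>k. inverse (fact (k + 2)) *\<^sub>R l ^ (k + 2))"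
      using summable_iff_shift[of "\<lambda>k. inverse (fact k) *\<^sub>R l ^ k" 2] summable_exp_generic[of l] by simp
  qed (use geo in \<open>auto simp: sums_iff\<close>)
  then have "exp l - 1 - l \<le> (l\<^sup>2 / 2) * (1 / (1 - l / 3))"
    using exp_first_two_terms[of l] geo by (simp add: sums_iff)
  then show ?thesis by simp
qed

lemma exp_le_affine:
  fixes y c :: real
  assumes "0 \<le> y" "y \<le> 1"
  shows "exp (c * y) \<le> 1 + y * (exp c - 1)"
proof -
  have "exp ((1 - y) *\<^sub>R 0 + y *\<^sub>R c) \<le> (1 - y) * exp 0 + y * exp c"
    by (rule convex_onD[OF exp_convex]) (use assms in auto)
  then show ?thesis by (simp add: algebra_simps)
qed

text \<open>An injection of \<open>V\<close> into \<open>B\<close> extends to all of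
  \<open>S\<close>: its image \<open>B'\<close> has the size of \<open>V\<close>, so the complements
  of \<open>V\<close> and \<open>B'\<close> in \<open>S\<close> are equinumerous and can be matched
  arbitrarily. This later moves the indices of a sequence of pairs into a prescribed block of the
  sample.\<close>

lemma ex_permutes_into:
  assumes "finite S" "V \<subseteq> S" "B \<subseteq> S" "card V \<le> card B"
  obtains p where "p permutes S" "p ` V \<subseteq> B"
proof -
  obtain B' where B': "B' \<subseteq> B" "card B' = card V"
    using obtain_subset_with_card_n[OF assms(4)] by blast
  have fin: "finite V" "finite B'"
    using finite_subset[OF assms(2,1)] finite_subset[OF B'(1) finite_subset[OF assms(3,1)]] by auto
  obtain f where f: "bij_betw f V B'"
    using finite_same_card_bij[OF fin] B'(2) by auto
  have "card (S - V) = card (S - B')"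
    using B' assms fin by (simp add: card_Diff_subset)
  then obtain g where g: "bij_betw g (S - V) (S - B')"
    using finite_same_card_bij[of "S - V" "S - B'"] assms by auto
  define p where "p x = (if x \<in> V then f x else if x \<in> S then g x else x)" for x
  have "bij_betw p V B'"
    using f by (rule bij_betw_cong[THEN iffD1, rotated]) (simp add: p_def)
  moreover have "bij_betw p (S - V) (S - B')"
    using g by (rule bij_betw_cong[THEN iffD1, rotated]) (simp add: p_def)
  ultimately have "bij_betw p (V \<union> (S - V)) (B' \<union> (S - B'))"
    by (rule bij_betw_combine) auto
  moreover have "V \<union> (S - V) = S" "B' \<union> (S - B') = S" using assms B' by auto
  ultimately have "p permutes S"
    using assms(2) by (intro bij_imp_permutes) (auto simp: p_def)
  moreover have "p ` V \<subseteq> B"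
    using f B' by (auto simp: p_def bij_betw_def)
  ultimately show ?thesis by (rule that)
qed

text \<open>Truncated exponents of \<open>L = card A\<close> are avoided by multiplying through with powers of \<open>L\<close>.\<close>

lemma
  fixes d :: "'b \<Rightarrow> real"
  assumes "finite A"
  defines "L \<equiv> real (card A)"
  shows sum_lists_sum_list:
      "L * (\<Sum>J | length J = m \<and> set J \<subseteq> A. sum_list (map d J)) = real m * L ^ m * sum d A" (is "?T m")
    and sum_lists_sum_list_sq:
      "L\<^sup>2 * (\<Sum>J | length J = m \<and> set J \<subseteq> A. (sum_list (map d J))\<^sup>2) =
       L ^ m * (real m * L * (\<Sum>a\<in>A. (d a)\<^sup>2) + real m * (real m - 1) * (sum d A)\<^sup>2)" (is "?Q m")
proof -
  define F where "F m = {J. length J = m \<and> set J \<subseteq> A}" for m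
  have card_F: "real (card (F m)) = L ^ m" for m
    using card_lists_length_eq[OF assms(1), of m] by (simp add: F_def L_def conj_commute)
  have sum_Suc: "(\<Sum>J\<in>F (Suc m). f J) = (\<Sum>a\<in>A. \<Sum>J\<in>F m. f (a # J))" for m and f :: "_ \<Rightarrow> real"
  proof -
    have "F (Suc m) = (\<lambda>(a, J). a # J) ` (A \<times> F m)"
      by (auto simp: F_def length_Suc_conv image_iff)
    then show ?thesis
      by (simp add: sum.reindex inj_on_def sum.cartesian_product case_prod_unfold)
  qed
  have F0: "F 0 = {[]}" by (auto simp: F_def)
  have T: "L * (\<Sum>J\<in>F m. sum_list (map d J)) = real m * L ^ m * sum d A" for m
  proof (induction m)
    case 0
    then show ?case by (simp add: F0)
  next
    case (Suc m)
    have "(\<Sum>J\<in>F (Suc m). sum_list (map d J)) = (\<Sum>a\<in>A. L ^ m * d a + (\<Sum>J\<in>F m. sum_list (map d J)))"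
      by (simp add: sum_Suc sum.distrib card_F)
    also have "\<dots> = L ^ m * sum d A + L * (\<Sum>J\<in>F m. sum_list (map d J))"
      by (simp only: sum.distrib sum_distrib_left[symmetric] sum_constant L_def)
    also have "\<dots> = L ^ m * sum d A + real m * L ^ m * sum d A"
      unfolding Suc ..
    finally show ?case by (simp add: algebra_simps)
  qed
  have Q: "L\<^sup>2 * (\<Sum>J\<in>F m. (sum_list (map d J))\<^sup>2) =
       L ^ m * (real m * L * (\<Sum>a\<in>A. (d a)\<^sup>2) + real m * (real m - 1) * (sum d A)\<^sup>2)" for m
  proof (induction m)
    case 0
    then show ?case by (simp add: F0)
  next
    case (Suc m)
    define U where "U = (\<Sum>J\<in>F m. sum_list (map d J))"
    define V where "V = (\<Sum>J\<in>F m. (sum_list (map d J))\<^sup>2)"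
    \<comment> \<open>Splitting off the head \<open>a\<close> and expanding the square produces the
      cross term \<open>2 * U * d a\<close>, so the recursion for second moments feeds on the first
      moment, which \<open>T\<close> supplies.\<close>
    have "(\<Sum>J\<in>F m. (d a + sum_list (map d J))\<^sup>2) = L ^ m * (d a)\<^sup>2 + 2 * U * d a + V" for a
      by (simp add: power2_sum sum.distrib card_F sum_distrib_left[symmetric] U_def V_def)
    then have "(\<Sum>J\<in>F (Suc m). (sum_list (map d J))\<^sup>2) = (\<Sum>a\<in>A. L ^ m * (d a)\<^sup>2 + 2 * U * d a + V)"
      by (simp add: sum_Suc)
    also have "\<dots> = L ^ m * (\<Sum>a\<in>A. (d a)\<^sup>2) + 2 * U * sum d A + L * V"
      by (simp only: sum.distrib sum_distrib_left[symmetric] sum_constant L_def)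
    finally have "L\<^sup>2 * (\<Sum>J\<in>F (Suc m). (sum_list (map d J))\<^sup>2) =
        L ^ m * L\<^sup>2 * (\<Sum>a\<in>A. (d a)\<^sup>2) + 2 * (L * U) * L * sum d A + L * (L\<^sup>2 * V)"
      by (simp add: distrib_left power2_eq_square)
    then show ?case
      unfolding Suc[folded V_def] T[of m, folded U_def]
      by (simp add: algebra_simps power2_eq_square)
  qed
  show "?T m" "?Q m" using T Q by (simp_all add: F_def)
qed

lemma (in prob_space) square_expectation_le:
  fixes f :: "'a \<Rightarrow> real"
  assumes "integrable M f" "integrable M (\<lambda>x. (f x)\<^sup>2)"
  shows "(expectation f)\<^sup>2 \<le> expectation (\<lambda>x. (f x)\<^sup>2)"
  using variance_eq[OF assms] variance_positive[of f] by simp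

subsection \<open>Symmetric kernels on a probability space\<close>

context pair_sigma_finite
begin

lemma integrable_mult_fst_snd:
  fixes f g :: "_ \<Rightarrow> real"
  assumes f: "integrable M1 f" and g: "integrable M2 g"
  shows "integrable (M1 \<Otimes>\<^sub>M M2) (\<lambda>p. f (fst p) * g (snd p))"
proof (rule Fubini_integrable)
  have [measurable]: "f \<in> borel_measurable M1" "g \<in> borel_measurable M2" using f g by auto
  show "(\<lambda>p. f (fst p) * g (snd p)) \<in> borel_measurable (M1 \<Otimes>\<^sub>M M2)" by measurable
qed (use f g in \<open>simp_all add: abs_mult integrable_mult_left_iff integrable_mult_right_iff\<close>)

lemma integral_mult_fst_snd:
  fixes f g :: "_ \<Rightarrow> real"
  assumes f: "integrable M1 f" and g: "integrable M2 g"
  shows "(\<integral>p. f (fst p) * g (snd p) \<partial>(M1 \<Otimes>\<^sub>M M2)) = (\<integral>x. f x \<partial>M1) * (\<integral>y. g y \<partial>M2)"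
  using integral_fst'[OF integrable_mult_fst_snd[OF f g]] by simp

end

text \<open>Domination by the sum of the squares, through the arithmetic-geometric mean
  inequality.\<close>

lemma integrable_mult_of_squares:
  fixes f g :: "'a \<Rightarrow> real"
  assumes [measurable]: "f \<in> borel_measurable M" "g \<in> borel_measurable M"
    and "integrable M (\<lambda>x. (f x)\<^sup>2)" "integrable M (\<lambda>x. (g x)\<^sup>2)"
  shows "integrable M (\<lambda>x. f x * g x)"
proof (rule Bochner_Integration.integrable_bound)
  show "integrable M (\<lambda>x. (f x)\<^sup>2 + (g x)\<^sup>2)" using assms by simp
  show "AE x in M. norm (f x * g x) \<le> norm ((f x)\<^sup>2 + (g x)\<^sup>2)"
  proof (rule AE_I2)
    fix x
    have "2 * (\<bar>f x\<bar> * \<bar>g x\<bar>) \<le> (f x)\<^sup>2 + (g x)\<^sup>2"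
      using sum_squares_bound[of "\<bar>f x\<bar>" "\<bar>g x\<bar>"] by (simp add: mult.assoc)
    moreover have "0 \<le> \<bar>f x\<bar> * \<bar>g x\<bar>" by simp
    ultimately have "\<bar>f x\<bar> * \<bar>g x\<bar> \<le> (f x)\<^sup>2 + (g x)\<^sup>2" by linarith
    then show "norm (f x * g x) \<le> norm ((f x)\<^sup>2 + (g x)\<^sup>2)" by (simp add: abs_mult)
  qed
qed measurable

context prob_space
begin

context
  fixes g :: "'a \<times> 'a \<Rightarrow> real"
  assumes g_meas [measurable]: "g \<in> borel_measurable (M \<Otimes>\<^sub>M M)"
    and g_sq: "integrable (M \<Otimes>\<^sub>M M) (\<lambda>p. (g p)\<^sup>2)"
begin

interpretation MM: pair_prob_space M M ..

interpretation MMM: pair_prob_space M "M \<Otimes>\<^sub>M M" ..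

lemma kernel_integrable: "integrable (M \<Otimes>\<^sub>M M) g"
  using MM.square_integrable_imp_integrable[OF g_meas g_sq] .

lemma AE_section_square_integrable:
  "AE x in M. integrable M (\<lambda>y. g (x, y)) \<and> integrable M (\<lambda>y. (g (x, y))\<^sup>2)"
  using MM.AE_integrable_fst'[OF kernel_integrable] MM.AE_integrable_fst'[OF g_sq] by auto

lemma projection_integrable: "integrable M (\<lambda>x. \<integral>y. g (x, y) \<partial>M)"
  by (rule MM.integrable_fst'[OF kernel_integrable])

text \<open>By Jensen on almost every section, the square of the section mean is dominated by the
  section mean of the square, which is integrable by Fubini.\<close>

lemma projection_square_integrable: "integrable M (\<lambda>x. (\<integral>y. g (x, y) \<partial>M)\<^sup>2)"
proof (rule Bochner_Integration.integrable_bound[OF MM.integrable_fst'[OF g_sq]])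
  show "AE x in M. norm ((\<integral>y. g (x, y) \<partial>M)\<^sup>2) \<le> norm (\<integral>y. (g (x, y))\<^sup>2 \<partial>M)"
    using AE_section_square_integrable
    by eventually_elim (auto intro: order_trans[OF square_expectation_le])
qed measurable

text \<open>Once \<open>x\<close> is fixed, \<open>y\<close> and \<open>z\<close> are independent
  with the same law, so the inner integral factorises into a square. This is the covariance of two
  kernel values that share one index.\<close>

lemma integral_shared_argument:
  assumes g2: "integrable (M \<Otimes>\<^sub>M (M \<Otimes>\<^sub>M M)) (\<lambda>(x, y, z). g (x, y) * g (x, z))"
  shows "(\<integral>(x, y, z). g (x, y) * g (x, z) \<partial>(M \<Otimes>\<^sub>M (M \<Otimes>\<^sub>M M))) = (\<integral>x. (\<integral>y. g (x, y) \<partial>M)\<^sup>2 \<partial>M)"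
proof -
  have "(\<integral>(x, y, z). g (x, y) * g (x, z) \<partial>(M \<Otimes>\<^sub>M (M \<Otimes>\<^sub>M M)))
      = (\<integral>x. (\<integral>(y, z). g (x, y) * g (x, z) \<partial>(M \<Otimes>\<^sub>M M)) \<partial>M)"
    using MMM.integral_fst'[OF g2] by simp
  also have "\<dots> = (\<integral>x. (\<integral>y. g (x, y) \<partial>M)\<^sup>2 \<partial>M)"
  proof (rule integral_cong_AE)
    show "AE x in M. (\<integral>(y, z). g (x, y) * g (x, z) \<partial>(M \<Otimes>\<^sub>M M)) = (\<integral>y. g (x, y) \<partial>M)\<^sup>2"
      using AE_section_square_integrable
    proof eventually_elim
      case (elim x)
      then show ?case
        using MM.integral_mult_fst_snd[of "\<lambda>y. g (x, y)" "\<lambda>y. g (x, y)"]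
        by (simp add: case_prod_unfold power2_eq_square)
    qed
  qed measurable
  finally show ?thesis .
qed

text \<open>The square of the degenerate part \<open>g p - f (fst p) - f (snd p)\<close> is
  expanded. Each \<open>f\<close> term contributes \<open>s\<close>, each of the two cross terms
  with \<open>g\<close> contributes \<open>- 2 * s\<close>, and the product of the two
  \<open>f\<close> terms integrates to 0 because \<open>f\<close> has mean 0. Hence the second
  moment of \<open>g\<close> minus \<open>2 * s\<close> is nonnegative.\<close>

lemma projection_second_moment_le:
  assumes mean0: "(\<integral>p. g p \<partial>(M \<Otimes>\<^sub>M M)) = 0"
    and sym: "\<And>x y. x \<in> space M \<Longrightarrow> y \<in> space M \<Longrightarrow> g (x, y) = g (y, x)"
  shows "2 * (\<integral>x. (\<integral>y. g (x, y) \<partial>M)\<^sup>2 \<partial>M) \<le> (\<integral>p. (g p)\<^sup>2 \<partial>(M \<Otimes>\<^sub>M M))"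
proof -
  define f where "f x = (\<integral>y. g (x, y) \<partial>M)" for x
  define s where "s = (\<integral>x. (f x)\<^sup>2 \<partial>M)"
  have f_meas [measurable]: "f \<in> borel_measurable M" unfolding f_def by measurable
  have f: "integrable M f" and f_sq: "integrable M (\<lambda>x. (f x)\<^sup>2)"
    unfolding f_def by (rule projection_integrable projection_square_integrable)+
  have "(\<integral>x. f x \<partial>M) = 0"
    using MM.integral_fst'[OF kernel_integrable] mean0 by (simp add: f_def)
  note fst_sq = MM.integrable_mult_fst_snd[OF f_sq integrable_const[of 1], simplified]
  note snd_sq = MM.integrable_mult_fst_snd[OF integrable_const[of 1] f_sq, simplified]
  note prods = MM.integrable_mult_fst_snd[OF f f]
  have gf: "integrable (M \<Otimes>\<^sub>M M) (\<lambda>p. g p * f (fst p))" "integrable (M \<Otimes>\<^sub>M M) (\<lambda>p. g p * f (snd p))"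
    by (rule integrable_mult_of_squares; use g_sq fst_sq snd_sq in simp)+
  have gf1: "(\<integral>p. g p * f (fst p) \<partial>(M \<Otimes>\<^sub>M M)) = s"
    using MM.integral_fst'[OF gf(1)] by (simp add: s_def f_def power2_eq_square)
  \<comment> \<open>Exchanging the coordinates and using the symmetry of \<open>g\<close> reduces
    the second cross term to the first.\<close>
  have "(\<integral>p. g p * f (snd p) \<partial>(M \<Otimes>\<^sub>M M)) = (\<integral>(x, y). g (y, x) * f x \<partial>(M \<Otimes>\<^sub>M M))"
    using MM.integral_product_swap[of "\<lambda>p. g p * f (snd p)"] by simp
  also have "\<dots> = (\<integral>p. g p * f (fst p) \<partial>(M \<Otimes>\<^sub>M M))"
    by (rule Bochner_Integration.integral_cong) (auto simp: space_pair_measure intro: sym)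
  finally have gf2: "(\<integral>p. g p * f (snd p) \<partial>(M \<Otimes>\<^sub>M M)) = s" using gf1 by simp
  have ff: "(\<integral>p. f (fst p) * f (snd p) \<partial>(M \<Otimes>\<^sub>M M)) = 0"
    using MM.integral_mult_fst_snd[OF f f] \<open>(\<integral>x. f x \<partial>M) = 0\<close> by simp
  have f1: "(\<integral>p. (f (fst p))\<^sup>2 \<partial>(M \<Otimes>\<^sub>M M)) = s"
    using MM.integral_mult_fst_snd[OF f_sq integrable_const[of 1]] by (simp add: s_def prob_space)
  have f2: "(\<integral>p. (f (snd p))\<^sup>2 \<partial>(M \<Otimes>\<^sub>M M)) = s"
    using MM.integral_mult_fst_snd[OF integrable_const[of 1] f_sq] by (simp add: s_def prob_space)
  have "0 \<le> (\<integral>p. (g p - f (fst p) - f (snd p))\<^sup>2 \<partial>(M \<Otimes>\<^sub>M M))" by simp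
  also have "\<dots> = (\<integral>p. (g p)\<^sup>2 + (f (fst p))\<^sup>2 + (f (snd p))\<^sup>2 + 2 * (f (fst p) * f (snd p))
      - 2 * (g p * f (fst p)) - 2 * (g p * f (snd p)) \<partial>(M \<Otimes>\<^sub>M M))"
    by (intro Bochner_Integration.integral_cong) (auto simp: power2_eq_square algebra_simps)
  also have "\<dots> = (\<integral>p. (g p)\<^sup>2 \<partial>(M \<Otimes>\<^sub>M M)) + s + s + 2 * 0 - 2 * s - 2 * s"
    using g_sq fst_sq snd_sq prods gf f1 f2 ff gf1 gf2 by simp
  finally show ?thesis by (simp add: s_def f_def)
qed

end

end

section \<open>Counting index pairs\<close>

lemma finite_index_pairs [simp]: "finite (index_pairs n)"
  by (rule finite_subset[of _ "{..n} \<times> {..n}"]) (auto simp: index_pairs_def)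

lemma card_index_pairs: "2 * real (card (index_pairs n)) = real n * (real n - 1)"
proof (induction n)
  case 0
  have "index_pairs 0 = {}" by (auto simp: index_pairs_def)
  then show ?case by simp
next
  case (Suc n)
  have "index_pairs (Suc n) = index_pairs n \<union> {1..n} \<times> {Suc n}"
    by (auto simp: index_pairs_def)
  moreover have "index_pairs n \<inter> {1..n} \<times> {Suc n} = {}"
    by (auto simp: index_pairs_def)
  ultimately have "card (index_pairs (Suc n)) = card (index_pairs n) + n"
    by (simp add: card_Un_disjoint)
  then show ?case using Suc by (simp add: algebra_simps)
qed

text \<open>A pair meeting \<open>{i, j}\<close> is determined by an endpoint \<open>a\<close> in
  \<open>{i, j}\<close> and its other endpoint \<open>x\<close>, up to sorting. The count includes
  the pair \<open>(i, j)\<close> itself and is deliberately crude.\<close>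

lemma card_adjacent_pairs_le:
  "card {q \<in> index_pairs n. {fst q, snd q} \<inter> {i, j} \<noteq> {}} \<le> 2 * n"
proof -
  have "{q \<in> index_pairs n. {fst q, snd q} \<inter> {i, j} \<noteq> {}}
      \<subseteq> (\<lambda>(a, x). (min a x, max a x)) ` ({i, j} \<times> {1..n})"
  proof
    fix q assume "q \<in> {q \<in> index_pairs n. {fst q, snd q} \<inter> {i, j} \<noteq> {}}"
    then obtain a b where q: "q = (a, b)" "1 \<le> a" "a < b" "b \<le> n" "a \<in> {i, j} \<or> b \<in> {i, j}"
      by (cases q) (auto simp: index_pairs_def)
    then show "q \<in> (\<lambda>(a, x). (min a x, max a x)) ` ({i, j} \<times> {1..n})"
      by (elim disjE) (rule image_eqI[of _ _ "(a, b)"], simp_all, rule image_eqI[of _ _ "(b, a)"], simp_all)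
  qed
  then have "card {q \<in> index_pairs n. {fst q, snd q} \<inter> {i, j} \<noteq> {}} \<le> card ({i, j} \<times> {1..n})"
    by (rule surj_card_le[rotated]) simp
  also have "\<dots> \<le> 2 * n"
    by (simp add: card_cartesian_product card_insert_if)
  finally show ?thesis .
qed

subsection \<open>Moments of the centred kernel\<close>

text \<open>The bound \<open>two_le_n\<close> puts \<open>X 1\<close> and \<open>X 2\<close>,
  through which the mean and both variances are defined, inside the i.i.d. range; in the theorem it
  follows from \<open>n \<ge> 2 * M\<close> and \<open>M \<ge> 1\<close>.\<close>

locale iid_kernel = prob_space P
  for P :: "'a measure" +
  fixes Z :: "'z measure" and X :: "nat \<Rightarrow> 'a \<Rightarrow> 'z" and n :: nat and h :: "'z \<times> 'z \<Rightarrow> real"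
  assumes iid: "iid_vars Z X n"
    and two_le_n: "2 \<le> n"
    and h_meas [measurable]: "h \<in> borel_measurable (Z \<Otimes>\<^sub>M Z)"
    and h_sym: "\<And>x y. x \<in> space Z \<Longrightarrow> y \<in> space Z \<Longrightarrow> h (x, y) = h (y, x)"
    and h_sq: "integrable P (\<lambda>\<omega>. (h (X 1 \<omega>, X 2 \<omega>))\<^sup>2)"
begin

definition law :: "'z measure" where
  "law = distr P Z (X 1)"

definition centred :: "'z \<times> 'z \<Rightarrow> real" where
  "centred p = h p - kernel_mean X h"

definition centred_at :: "nat \<times> nat \<Rightarrow> 'a \<Rightarrow> real" where
  "centred_at p \<omega> = centred (X (fst p) \<omega>, X (snd p) \<omega>)"

lemma indep: "indep_vars (\<lambda>_. Z) X {1..n}"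
  using iid by (simp add: iid_vars_def)

lemma X_meas: "i \<in> {1..n} \<Longrightarrow> X i \<in> measurable P Z"
  using indep by (simp add: indep_vars_def)

lemma one_two_in: "1 \<in> {1..n}" "2 \<in> {1..n}"
  using two_le_n by auto

lemma distr_X: "i \<in> {1..n} \<Longrightarrow> distr P Z (X i) = law"
  using iid one_two_in unfolding iid_vars_def law_def by blast

lemma sets_law [measurable_cong, simp]: "sets law = sets Z"
  by (simp add: law_def)

lemma space_law [simp]: "space law = space Z"
  by (simp add: law_def)

sublocale law: prob_space law
  unfolding law_def by (rule prob_space_distr[OF X_meas[OF one_two_in(1)]])

sublocale law2: pair_prob_space law law ..

sublocale law3: pair_prob_space law "law \<Otimes>\<^sub>M law" ..

lemma indep_var_blocks:
  assumes "A \<inter> B = {}" "A \<subseteq> {1..n}" "B \<subseteq> {1..n}"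
    and "f \<in> measurable (PiM A (\<lambda>_. Z)) N1" "g \<in> measurable (PiM B (\<lambda>_. Z)) N2"
  shows "indep_var N1 (\<lambda>\<omega>. f (\<lambda>i\<in>A. X i \<omega>)) N2 (\<lambda>\<omega>. g (\<lambda>i\<in>B. X i \<omega>))"
  using indep_var_compose[OF indep_var_restrict[OF indep assms(1-3)] assms(4,5)]
  by (simp add: comp_def)

lemma indep_var_X_pair:
  assumes "i \<in> {1..n}" "j \<in> {1..n}" "i \<noteq> j"
  shows "indep_var Z (X i) Z (X j)"
  using indep_var_blocks[of "{i}" "{j}" "\<lambda>x. x i" Z "\<lambda>x. x j" Z] assms
  by (simp add: measurable_component_singleton)

lemma distr_X_pair:
  assumes "i \<in> {1..n}" "j \<in> {1..n}" "i \<noteq> j"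
  shows "distr P (Z \<Otimes>\<^sub>M Z) (\<lambda>\<omega>. (X i \<omega>, X j \<omega>)) = law \<Otimes>\<^sub>M law"
  using indep_var_X_pair[OF assms] assms by (simp add: indep_var_distribution_eq distr_X)

text \<open>The triple is read as two independent blocks, \<open>{i}\<close> and
  \<open>{j, k}\<close>. Their joint law is a product, evaluating coordinates maps it to a product
  again, and the second factor is known from \<open>distr_X_pair\<close>.\<close>

lemma distr_X_triple:
  assumes ijk: "i \<in> {1..n}" "j \<in> {1..n}" "k \<in> {1..n}" "i \<noteq> j" "i \<noteq> k" "j \<noteq> k"
  shows "distr P (Z \<Otimes>\<^sub>M (Z \<Otimes>\<^sub>M Z)) (\<lambda>\<omega>. (X i \<omega>, X j \<omega>, X k \<omega>)) = law \<Otimes>\<^sub>M (law \<Otimes>\<^sub>M law)"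
proof -
  let ?A = "PiM {i} (\<lambda>_. Z)" and ?B = "PiM {j, k} (\<lambda>_. Z)"
  let ?R = "\<lambda>I \<omega>. \<lambda>l\<in>I. X l \<omega>"
  have [measurable]: "(\<lambda>x. x l) \<in> measurable ?B Z" if "l \<in> {j, k}" for l
    using that by (rule measurable_component_singleton)
  have [measurable]: "(\<lambda>x. x i) \<in> measurable ?A Z"
    by (rule measurable_component_singleton) simp
  have [measurable]: "?R I \<in> measurable P (PiM I (\<lambda>_. Z))" if "I \<subseteq> {1..n}" for I
    using that X_meas by (intro measurable_restrict) auto
  have R [measurable]: "?R {i} \<in> measurable P ?A" "?R {j, k} \<in> measurable P ?B"
    using ijk by auto
  have "distr P ?A (?R {i}) \<Otimes>\<^sub>M distr P ?B (?R {j, k}) = distr P (?A \<Otimes>\<^sub>M ?B) (\<lambda>\<omega>. (?R {i} \<omega>, ?R {j, k} \<omega>))"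
    using indep_var_restrict[OF indep, of "{i}" "{j, k}"] ijk by (simp add: indep_var_distribution_eq)
  then have "distr (distr P ?A (?R {i}) \<Otimes>\<^sub>M distr P ?B (?R {j, k})) (Z \<Otimes>\<^sub>M (Z \<Otimes>\<^sub>M Z)) (\<lambda>(u, v). (u i, v j, v k))
      = distr P (Z \<Otimes>\<^sub>M (Z \<Otimes>\<^sub>M Z)) (\<lambda>\<omega>. (X i \<omega>, X j \<omega>, X k \<omega>))"
    by (simp add: distr_distr comp_def)
  moreover have "distr (distr P ?A (?R {i}) \<Otimes>\<^sub>M distr P ?B (?R {j, k})) (Z \<Otimes>\<^sub>M (Z \<Otimes>\<^sub>M Z)) (\<lambda>(u, v). (u i, v j, v k))
      = distr (distr P ?A (?R {i})) Z (\<lambda>u. u i) \<Otimes>\<^sub>M distr (distr P ?B (?R {j, k})) (Z \<Otimes>\<^sub>M Z) (\<lambda>v. (v j, v k))"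
  proof (rule pair_measure_distr[symmetric])
    show "sigma_finite_measure (distr (distr P ?B (?R {j, k})) (Z \<Otimes>\<^sub>M Z) (\<lambda>v. (v j, v k)))"
      using R by (intro prob_space_imp_sigma_finite prob_space.prob_space_distr prob_space_distr) auto
  qed auto
  moreover have "distr (distr P ?A (?R {i})) Z (\<lambda>u. u i) = law"
    using ijk by (simp add: distr_distr comp_def distr_X)
  moreover have "distr (distr P ?B (?R {j, k})) (Z \<Otimes>\<^sub>M Z) (\<lambda>v. (v j, v k)) = law \<Otimes>\<^sub>M law"
    using ijk by (simp add: distr_distr comp_def distr_X_pair)
  ultimately show ?thesis by simp
qed

lemma centred_meas [measurable]: "centred \<in> borel_measurable (Z \<Otimes>\<^sub>M Z)"
  unfolding centred_def by measurable

lemma centred_at_meas: "p \<in> index_pairs n \<Longrightarrow> centred_at p \<in> borel_measurable P"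
proof -
  assume "p \<in> index_pairs n"
  then have [measurable]: "X (fst p) \<in> measurable P Z" "X (snd p) \<in> measurable P Z"
    by (auto simp: index_pairs_def intro!: X_meas)
  show ?thesis unfolding centred_at_def by measurable
qed

lemma h_integrable: "integrable P (\<lambda>\<omega>. h (X 1 \<omega>, X 2 \<omega>))"
proof (rule square_integrable_imp_integrable[OF _ h_sq])
  have [measurable]: "X 1 \<in> measurable P Z" "X 2 \<in> measurable P Z"
    using X_meas one_two_in by blast+
  show "(\<lambda>\<omega>. h (X 1 \<omega>, X 2 \<omega>)) \<in> borel_measurable P" by measurable
qed

lemma centred_sq: "integrable P (\<lambda>\<omega>. (centred (X 1 \<omega>, X 2 \<omega>))\<^sup>2)"
  using h_sq h_integrable by (simp add: centred_def power2_diff mult.assoc)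

lemma integrable_pair_iff:
  fixes f :: "'z \<times> 'z \<Rightarrow> real"
  assumes "i \<in> {1..n}" "j \<in> {1..n}" "i \<noteq> j" and [measurable]: "f \<in> borel_measurable (Z \<Otimes>\<^sub>M Z)"
  shows "integrable P (\<lambda>\<omega>. f (X i \<omega>, X j \<omega>)) \<longleftrightarrow> integrable (law \<Otimes>\<^sub>M law) f"
    and "expectation (\<lambda>\<omega>. f (X i \<omega>, X j \<omega>)) = (\<integral>p. f p \<partial>(law \<Otimes>\<^sub>M law))"
proof -
  have [measurable]: "X i \<in> measurable P Z" "X j \<in> measurable P Z"
    using X_meas assms by blast+
  show "integrable P (\<lambda>\<omega>. f (X i \<omega>, X j \<omega>)) \<longleftrightarrow> integrable (law \<Otimes>\<^sub>M law) f"
    unfolding distr_X_pair[OF assms(1-3), symmetric] by (subst integrable_distr_eq) auto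
  show "expectation (\<lambda>\<omega>. f (X i \<omega>, X j \<omega>)) = (\<integral>p. f p \<partial>(law \<Otimes>\<^sub>M law))"
    unfolding distr_X_pair[OF assms(1-3), symmetric] by (subst integral_distr) auto
qed

lemma centred_law_sq: "integrable (law \<Otimes>\<^sub>M law) (\<lambda>p. (centred p)\<^sup>2)"
  using centred_sq integrable_pair_iff(1)[of 1 2 "\<lambda>p. (centred p)\<^sup>2"] one_two_in by simp

lemma centred_law_meas: "centred \<in> borel_measurable (law \<Otimes>\<^sub>M law)"
  by measurable

lemmas centred_projection_facts =
  law.kernel_integrable[OF centred_law_meas centred_law_sq]
  law.projection_integrable[OF centred_law_meas centred_law_sq]
  law.projection_square_integrable[OF centred_law_meas centred_law_sq]

lemma centred_law_mean: "(\<integral>p. centred p \<partial>(law \<Otimes>\<^sub>M law)) = 0"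
proof -
  have "(\<integral>p. centred p \<partial>(law \<Otimes>\<^sub>M law)) = expectation (\<lambda>\<omega>. h (X 1 \<omega>, X 2 \<omega>) - kernel_mean X h)"
    using integrable_pair_iff(2)[of 1 2 centred] one_two_in by (simp add: centred_def)
  also have "\<dots> = 0"
    using h_integrable by (simp add: kernel_mean_def prob_space)
  finally show ?thesis .
qed

lemma kernel_var_eq: "kernel_var X h = (\<integral>p. (centred p)\<^sup>2 \<partial>(law \<Otimes>\<^sub>M law))"
  using integrable_pair_iff(2)[of 1 2 "\<lambda>p. (centred p)\<^sup>2"] one_two_in
  by (simp add: kernel_var_def centred_def kernel_mean_def)

text \<open>The first-order term of the Hoeffding decomposition of the centred kernel.\<close>

definition projection :: "'z \<Rightarrow> real" where
  "projection x = (\<integral>y. centred (x, y) \<partial>law)"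

lemma projection_meas [measurable]: "projection \<in> borel_measurable Z"
proof -
  have "projection \<in> borel_measurable law"
    unfolding projection_def using centred_law_meas by measurable
  then show ?thesis by (simp cong: measurable_cong_sets)
qed

lemma projection_X_integrable: "integrable P (\<lambda>\<omega>. projection (X 1 \<omega>))"
  using centred_projection_facts(2) integrable_distr_eq[OF X_meas[OF one_two_in(1)] projection_meas]
  by (simp add: projection_def[symmetric] law_def[symmetric] del: One_nat_def)

text \<open>The characterising property of conditional expectation is checked. An event generated by
  \<open>X 1\<close> is a preimage of some \<open>B\<close>, so integrating the centred kernel over
  it is an integral against the product law, where Fubini integrates out the second
  argument.\<close>

lemma cond_exp_eq:
  "AE \<omega> in P. real_cond_exp P (vimage_algebra (space P) (X 1) Z) (\<lambda>\<omega>. h (X 1 \<omega>, X 2 \<omega>)) \<omega>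
     = projection (X 1 \<omega>) + kernel_mean X h"
proof -
  let ?F = "vimage_algebra (space P) (X 1) Z"
  have X1 [measurable]: "X 1 \<in> measurable P Z" and X2 [measurable]: "X 2 \<in> measurable P Z"
    using X_meas one_two_in by blast+
  have sub: "subalgebra P ?F"
    using X1 by (auto simp: subalgebra_def sets_vimage_algebra2 measurable_space dest: measurable_sets)
  interpret F: finite_measure_subalgebra P ?F
    by unfold_locales (rule sub)
  note proj = projection_X_integrable
  show ?thesis
  proof (rule F.real_cond_exp_charact)
    fix A assume "A \<in> sets ?F"
    then obtain B where B [measurable]: "B \<in> sets Z" and A: "A = X 1 -` B \<inter> space P"
      using X1 by (auto simp: sets_vimage_algebra2 measurable_space)
    have [measurable]: "A \<in> sets P" unfolding A by measurable
    have indB: "indicator A \<omega> = (indicator B (X 1 \<omega>) :: real)" if "\<omega> \<in> space P" for \<omega>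
      using that by (auto simp: A indicator_def)
    let ?f = "\<lambda>p. indicator B (fst p) * centred p"
    have int: "integrable (law \<Otimes>\<^sub>M law) ?f"
      by (rule Bochner_Integration.integrable_bound[OF centred_projection_facts(1)])
        (auto simp: indicator_def)
    have "(\<integral>\<omega>\<in>A. centred (X 1 \<omega>, X 2 \<omega>) \<partial>P) = expectation (\<lambda>\<omega>. ?f (X 1 \<omega>, X 2 \<omega>))"
      unfolding set_lebesgue_integral_def
      by (rule Bochner_Integration.integral_cong) (auto simp: indB)
    also have "\<dots> = (\<integral>p. ?f p \<partial>(law \<Otimes>\<^sub>M law))"
      by (rule integrable_pair_iff(2)) (use one_two_in in auto)
    also have "\<dots> = (\<integral>x. indicator B x * projection x \<partial>law)"
      using law2.integral_fst'[OF int] by (simp add: projection_def)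
    also have "\<dots> = expectation (\<lambda>\<omega>. indicator B (X 1 \<omega>) * projection (X 1 \<omega>))"
      unfolding law_def by (rule integral_distr) (auto simp del: One_nat_def)
    also have "\<dots> = (\<integral>\<omega>\<in>A. projection (X 1 \<omega>) \<partial>P)"
      unfolding set_lebesgue_integral_def
      by (rule Bochner_Integration.integral_cong) (auto simp: indB)
    finally have eq: "(\<integral>\<omega>\<in>A. centred (X 1 \<omega>, X 2 \<omega>) \<partial>P) = (\<integral>\<omega>\<in>A. projection (X 1 \<omega>) \<partial>P)" .
    have cint: "integrable P (\<lambda>\<omega>. centred (X 1 \<omega>, X 2 \<omega>))"
      using h_integrable by (simp add: centred_def)
    have si: "set_integrable P A (\<lambda>\<omega>. centred (X 1 \<omega>, X 2 \<omega>))" "set_integrable P A (\<lambda>\<omega>. projection (X 1 \<omega>))"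
      "set_integrable P A (\<lambda>\<omega>. kernel_mean X h)"
      unfolding set_integrable_def
      by (rule integrable_mult_indicator; use cint proj in simp)+
    \<comment> \<open>Fubini was applied to the centred kernel only; the constant
      \<open>kernel_mean X h\<close> is now restored on both sides.\<close>
    have "(\<integral>\<omega>\<in>A. h (X 1 \<omega>, X 2 \<omega>) \<partial>P) = (\<integral>\<omega>\<in>A. centred (X 1 \<omega>, X 2 \<omega>) + kernel_mean X h \<partial>P)"
      by (simp add: centred_def)
    also have "\<dots> = (\<integral>\<omega>\<in>A. projection (X 1 \<omega>) + kernel_mean X h \<partial>P)"
      using si eq by (simp add: set_integral_add)
    finally show "(\<integral>\<omega>\<in>A. h (X 1 \<omega>, X 2 \<omega>) \<partial>P) = (\<integral>\<omega>\<in>A. projection (X 1 \<omega>) + kernel_mean X h \<partial>P)" .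
  next
    have "X 1 \<in> measurable ?F Z"
      using X1 by (intro measurable_vimage_algebra1) (auto simp: measurable_space)
    then show "(\<lambda>\<omega>. projection (X 1 \<omega>) + kernel_mean X h) \<in> borel_measurable ?F"
      by measurable
  qed (use h_integrable proj in auto)
qed

lemma projection_mean: "(\<integral>x. projection x \<partial>law) = 0"
  using law2.integral_fst'[OF centred_projection_facts(1)] centred_law_mean by (simp add: projection_def)

lemma kernel_var1_eq: "kernel_var1 Z X h = (\<integral>x. (projection x)\<^sup>2 \<partial>law)"
proof -
  let ?F = "vimage_algebra (space P) (X 1) Z"
  let ?E = "real_cond_exp P ?F (\<lambda>\<omega>. h (X 1 \<omega>, X 2 \<omega>))"
  have X1 [measurable]: "X 1 \<in> measurable P Z"
    using X_meas one_two_in by blast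
  note proj = projection_X_integrable
  have "expectation ?E = expectation (\<lambda>\<omega>. projection (X 1 \<omega>) + kernel_mean X h)"
    by (rule integral_cong_AE) (use cond_exp_eq in \<open>auto simp del: One_nat_def\<close>)
  also have "\<dots> = (\<integral>x. projection x \<partial>law) + kernel_mean X h"
    using proj by (simp add: prob_space law_def integral_distr del: One_nat_def)
  finally have mean: "expectation ?E = kernel_mean X h"
    by (simp add: projection_mean)
  have "kernel_var1 Z X h = expectation (\<lambda>\<omega>. (projection (X 1 \<omega>))\<^sup>2)"
    unfolding kernel_var1_def mean
    by (rule integral_cong_AE) (use cond_exp_eq in \<open>auto simp del: One_nat_def\<close>)
  also have "\<dots> = (\<integral>x. (projection x)\<^sup>2 \<partial>law)"
    unfolding law_def by (rule integral_distr[symmetric]) (auto simp del: One_nat_def)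
  finally show ?thesis .
qed

lemma kernel_var1_nonneg: "0 \<le> kernel_var1 Z X h"
  by (simp add: kernel_var1_eq)

lemma kernel_var_nonneg: "0 \<le> kernel_var X h"
  by (simp add: kernel_var_eq)

lemma kernel_var1_le: "2 * kernel_var1 Z X h \<le> kernel_var X h"
  unfolding kernel_var1_eq kernel_var_eq projection_def
  by (rule law.projection_second_moment_le[OF centred_law_meas centred_law_sq centred_law_mean])
    (simp add: centred_def h_sym)

section \<open>Covariances of the kernel at two index pairs\<close>

lemma centred_at_sq_integrable:
  assumes "p \<in> index_pairs n"
  shows "integrable P (\<lambda>\<omega>. (centred_at p \<omega>)\<^sup>2)"
  using integrable_pair_iff(1)[of "fst p" "snd p" "\<lambda>p. (centred p)\<^sup>2"] assms centred_law_sq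
  by (auto simp: centred_at_def index_pairs_def)

lemma centred_at_mult_integrable:
  assumes "p \<in> index_pairs n" "q \<in> index_pairs n"
  shows "integrable P (\<lambda>\<omega>. centred_at p \<omega> * centred_at q \<omega>)"
  by (intro integrable_mult_of_squares centred_at_meas centred_at_sq_integrable assms)

lemma variance_centred_at:
  assumes "p \<in> index_pairs n"
  shows "expectation (\<lambda>\<omega>. (centred_at p \<omega>)\<^sup>2) = kernel_var X h"
  using integrable_pair_iff(2)[of "fst p" "snd p" "\<lambda>p. (centred p)\<^sup>2"] assms
  by (auto simp: centred_at_def index_pairs_def kernel_var_eq)

lemma covariance_shared:
  assumes ijk: "i \<in> {1..n}" "j \<in> {1..n}" "k \<in> {1..n}" "i \<noteq> j" "i \<noteq> k" "j \<noteq> k"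
  shows "expectation (\<lambda>\<omega>. centred (X i \<omega>, X j \<omega>) * centred (X i \<omega>, X k \<omega>)) = kernel_var1 Z X h"
proof -
  have [measurable]: "X i \<in> measurable P Z" "X j \<in> measurable P Z" "X k \<in> measurable P Z"
    using X_meas ijk by blast+
  let ?f = "\<lambda>(x, y, z). centred (x, y) * centred (x, z)"
  have "integrable P (\<lambda>\<omega>. centred (X i \<omega>, X j \<omega>) * centred (X i \<omega>, X k \<omega>))"
    using integrable_pair_iff(1)[of i j "\<lambda>p. (centred p)\<^sup>2"] integrable_pair_iff(1)[of i k "\<lambda>p. (centred p)\<^sup>2"]
      centred_law_sq ijk
    by (intro integrable_mult_of_squares) auto
  then have int: "integrable (law \<Otimes>\<^sub>M (law \<Otimes>\<^sub>M law)) ?f"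
    unfolding distr_X_triple[OF ijk, symmetric] by (subst integrable_distr_eq) auto
  have "expectation (\<lambda>\<omega>. centred (X i \<omega>, X j \<omega>) * centred (X i \<omega>, X k \<omega>))
      = (\<integral>p. ?f p \<partial>(law \<Otimes>\<^sub>M (law \<Otimes>\<^sub>M law)))"
    unfolding distr_X_triple[OF ijk, symmetric] by (subst integral_distr) auto
  also have "\<dots> = kernel_var1 Z X h"
    unfolding kernel_var1_eq projection_def
    by (rule law.integral_shared_argument[OF centred_law_meas centred_law_sq int])
  finally show ?thesis .
qed

lemma centred_X_commute:
  assumes "i \<in> {1..n}" "j \<in> {1..n}" "\<omega> \<in> space P"
  shows "centred (X i \<omega>, X j \<omega>) = centred (X j \<omega>, X i \<omega>)"
  using assms measurable_space[OF X_meas] by (simp add: centred_def h_sym)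

text \<open>Distinct pairs that meet share exactly one index. As pairs are increasing, it can be the
  first or second entry of either one, giving four cases; symmetry of the kernel moves it to the
  front in both pairs.\<close>

lemma covariance_shared_pairs:
  assumes p: "p \<in> index_pairs n" and q: "q \<in> index_pairs n" and "p \<noteq> q"
    and "{fst q, snd q} \<inter> {fst p, snd p} \<noteq> {}"
  shows "expectation (\<lambda>\<omega>. centred_at p \<omega> * centred_at q \<omega>) = kernel_var1 Z X h"
proof -
  obtain i j k where ijk: "i \<in> {1..n}" "j \<in> {1..n}" "k \<in> {1..n}" "i \<noteq> j" "i \<noteq> k" "j \<noteq> k"
    and pq: "p = (i, j) \<or> p = (j, i)" "q = (i, k) \<or> q = (k, i)"
  proof -
    obtain a b c d where ab: "p = (a, b)" "q = (c, d)" by (cases p, cases q)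
    have ord: "1 \<le> a" "a < b" "b \<le> n" "1 \<le> c" "c < d" "d \<le> n"
      using p q by (auto simp: ab index_pairs_def)
    consider "a = c" "b \<noteq> d" | "a = d" "b \<noteq> c" | "b = c" "a \<noteq> d" | "b = d" "a \<noteq> c"
      using assms(3,4) ord by (auto simp: ab)
    then show thesis
    proof cases
      case 1 then show thesis using ord ab by (intro that[of a b d]) auto
    next
      case 2 then show thesis using ord ab by (intro that[of a b c]) auto
    next
      case 3 then show thesis using ord ab by (intro that[of b a d]) auto
    next
      case 4 then show thesis using ord ab by (intro that[of b a c]) auto
    qed
  qed
  have "expectation (\<lambda>\<omega>. centred_at p \<omega> * centred_at q \<omega>)
      = expectation (\<lambda>\<omega>. centred (X i \<omega>, X j \<omega>) * centred (X i \<omega>, X k \<omega>))"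
    using pq ijk
    by (intro Bochner_Integration.integral_cong) (auto simp: centred_at_def centred_X_commute)
  then show ?thesis using covariance_shared[OF ijk] by simp
qed

lemma covariance_disjoint_pairs:
  assumes p: "p \<in> index_pairs n" and q: "q \<in> index_pairs n"
    and disj: "{fst q, snd q} \<inter> {fst p, snd p} = {}"
  shows "expectation (\<lambda>\<omega>. centred_at p \<omega> * centred_at q \<omega>) = 0"
proof -
  define f where "f r x = centred (x (fst r), x (snd r))" for r :: "nat \<times> nat" and x
  have f_meas: "f r \<in> borel_measurable (PiM {fst r, snd r} (\<lambda>_. Z))" for r
  proof -
    have [measurable]: "(\<lambda>x. x l) \<in> measurable (PiM {fst r, snd r} (\<lambda>_. Z)) Z" if "l \<in> {fst r, snd r}" for l
      using that by (rule measurable_component_singleton)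
    show ?thesis unfolding f_def by measurable
  qed
  have "indep_var borel (centred_at p) borel (centred_at q)"
    using indep_var_blocks[OF _ _ _ f_meas[of p] f_meas[of q]] p q disj
    by (auto simp: f_def centred_at_def[abs_def] index_pairs_def Int_commute)
  moreover have int: "integrable P (centred_at r)" "expectation (centred_at r) = 0" if "r \<in> index_pairs n" for r
    using integrable_pair_iff[of "fst r" "snd r" centred] that centred_projection_facts(1) centred_law_mean
    by (auto simp: centred_at_def[abs_def] index_pairs_def)
  ultimately show ?thesis
    using p q by (simp add: indep_var_lebesgue_integral)
qed

text \<open>In each row of the covariance matrix the diagonal contributes
  \<open>kernel_var X h\<close>, at most \<open>2 * n\<close> pairs share an index with
  \<open>p\<close> and contribute \<open>kernel_var1 Z X h\<close> each, and disjoint pairs are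
  uncorrelated.\<close>

lemma sum_centred_at_second_moment_le:
  "expectation (\<lambda>\<omega>. (\<Sum>p\<in>index_pairs n. centred_at p \<omega>)\<^sup>2)
    \<le> real (card (index_pairs n)) * (kernel_var X h + 2 * real n * kernel_var1 Z X h)"
proof -
  let ?I = "index_pairs n"
  let ?C = "\<lambda>p q. expectation (\<lambda>\<omega>. centred_at p \<omega> * centred_at q \<omega>)"
  have "expectation (\<lambda>\<omega>. (\<Sum>p\<in>?I. centred_at p \<omega>)\<^sup>2) = (\<Sum>p\<in>?I. \<Sum>q\<in>?I. ?C p q)"
    by (simp add: power2_eq_square sum_product centred_at_mult_integrable)
  also have "\<dots> \<le> (\<Sum>p\<in>?I. kernel_var X h + 2 * real n * kernel_var1 Z X h)"
  proof (rule sum_mono)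
    fix p assume p: "p \<in> ?I"
    let ?A = "{q \<in> ?I. {fst q, snd q} \<inter> {fst p, snd p} \<noteq> {}}"
    \<comment> \<open>The set \<open>?A\<close> contains \<open>p\<close> itself, so the diagonal
      entry is overestimated by \<open>kernel_var1 Z X h\<close>, which is nonnegative.\<close>
    have "(\<Sum>q\<in>?I. ?C p q) \<le> (\<Sum>q\<in>?I. (if q = p then kernel_var X h else 0) + (if q \<in> ?A then kernel_var1 Z X h else 0))"
    proof (rule sum_mono)
      fix q assume q: "q \<in> ?I"
      consider "q = p" | "q \<noteq> p" "q \<in> ?A" | "q \<noteq> p" "q \<notin> ?A" by blast
      then show "?C p q \<le> (if q = p then kernel_var X h else 0) + (if q \<in> ?A then kernel_var1 Z X h else 0)"
      proof cases
        case 1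
        then show ?thesis
          using variance_centred_at[OF p] kernel_var1_nonneg by (simp add: power2_eq_square)
      next
        case 2
        then show ?thesis using covariance_shared_pairs[OF p q] by auto
      next
        case 3
        then show ?thesis using covariance_disjoint_pairs[OF p q] q by auto
      qed
    qed
    also have "\<dots> = kernel_var X h + real (card ?A) * kernel_var1 Z X h"
      using p by (simp add: sum.distrib sum.If_cases Int_def)
    also have "\<dots> \<le> kernel_var X h + 2 * real n * kernel_var1 Z X h"
      using card_adjacent_pairs_le[of n "fst p" "snd p"] kernel_var1_nonneg
      by (intro add_left_mono mult_right_mono) auto
    finally show "(\<Sum>q\<in>?I. ?C p q) \<le> kernel_var X h + 2 * real n * kernel_var1 Z X h" .
  qed
  finally show ?thesis by simp
qed

end

section \<open>Counting sequences; Chebyshev and Bernstein for real numbers\<close>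

lemma finite_pair_seqs [simp]: "finite (pair_seqs n m)"
  using finite_lists_length_eq[OF finite_index_pairs, of n m] by (simp add: pair_seqs_def conj_commute)

lemma card_pair_seqs: "card (pair_seqs n m) = card (index_pairs n) ^ m"
  using card_lists_length_eq[OF finite_index_pairs, of n m] by (simp add: pair_seqs_def conj_commute)

lemma of_bool_abs_ge_le_square:
  fixes u e :: real
  assumes "0 < e"
  shows "of_bool (e \<le> \<bar>u\<bar>) \<le> u\<^sup>2 / e\<^sup>2"
  using assms power_mono[of e "\<bar>u\<bar>" 2] by (auto simp: field_simps)

text \<open>The case \<open>s = 0\<close> is degenerate: the usual choice \<open>\<lambda> = t / (s + t / 3) = 3\<close> is
  then not admissible, and \<open>\<lambda> = 3 / 2\<close> gives the same bound.\<close>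

lemma bernstein_exponent:
  fixes s t :: real
  assumes "0 \<le> s" "0 < t"
  obtains l where "0 < l" "s * (exp l - 1 - l) - l * t \<le> - t\<^sup>2 / (2 * (s + t / 3))"
proof (cases "s = 0")
  case True
  then show thesis
    using assms by (intro that[of "3 / 2"]) (auto simp: field_simps power2_eq_square)
next
  case False
  define l where "l = t / (s + t / 3)"
  have pos: "0 < s" "0 < s + t / 3" using False assms by auto
  have l: "0 < l" "l < 3" using pos assms by (auto simp: l_def field_simps)
  \<comment> \<open>With this \<open>l\<close> the denominator \<open>1 - l / 3\<close> cancels the
    factor \<open>s\<close>, and \<open>l * (s + t / 3) = t\<close> reduces the bound to
    \<open>l * t / 2\<close>. So half of the linear term \<open>l * t\<close> survives.\<close>
  have "1 - l / 3 = s / (s + t / 3)" using pos by (simp add: l_def field_simps)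
  moreover have "s * (exp l - 1 - l) \<le> s * (l\<^sup>2 / (2 * (1 - l / 3)))"
    using exp_minus_linear_le[of l] l pos by (intro mult_left_mono) auto
  ultimately have "s * (exp l - 1 - l) \<le> l\<^sup>2 * (s + t / 3) / 2"
    using pos by simp
  also have "l\<^sup>2 * (s + t / 3) / 2 = l * t / 2"
    using pos by (simp add: l_def power2_eq_square)
  finally have "s * (exp l - 1 - l) - l * t \<le> - (l * t / 2)" by simp
  also have "\<dots> = - t\<^sup>2 / (2 * (s + t / 3))"
    using pos by (simp add: l_def power2_eq_square mult.commute)
  finally show thesis using l that by blast
qed

subsection \<open>The mean deviation frequency\<close>

context iid_kernel
begin

text \<open>The indicator is a function of the sample points \<open>x\<close> rather than of the
  outcome, so that it can be composed with permutations of the indices and regarded as a function of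
  finitely many coordinates.\<close>

definition deviates :: "nat \<Rightarrow> real \<Rightarrow> (nat \<times> nat) list \<Rightarrow> (nat \<Rightarrow> 'z) \<Rightarrow> real" where
  "deviates m \<epsilon> J x = of_bool (\<epsilon> \<le> \<bar>(\<Sum>p\<leftarrow>J. centred (x (fst p), x (snd p))) / real m\<bar>)"

lemma incomplete_U_centred:
  assumes "1 \<le> m" "length J = m"
  shows "incomplete_U m X h J \<omega> - kernel_mean X h = (\<Sum>p\<leftarrow>J. centred_at p \<omega>) / real m"
proof -
  have "(\<Sum>p\<leftarrow>J. centred_at p \<omega>) = (\<Sum>(i, j)\<leftarrow>J. h (X i \<omega>, X j \<omega>)) - real (length J) * kernel_mean X h"
    by (induction J) (auto simp: centred_at_def centred_def case_prod_unfold algebra_simps)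
  then show ?thesis
    using assms by (simp add: incomplete_U_def field_simps)
qed

lemma deviation_freq_eq:
  assumes "1 \<le> m"
  shows "deviation_freq n m X h \<epsilon> \<omega>
    = (\<Sum>J\<in>pair_seqs n m. deviates m \<epsilon> J (\<lambda>i. X i \<omega>)) / real (card (pair_seqs n m))"
proof -
  have "of_bool (\<epsilon> \<le> \<bar>incomplete_U m X h J \<omega> - kernel_mean X h\<bar>) = deviates m \<epsilon> J (\<lambda>i. X i \<omega>)"
    if "J \<in> pair_seqs n m" for J
    using that incomplete_U_centred[OF assms, of J \<omega>]
    by (simp add: deviates_def pair_seqs_def centred_at_def)
  then show ?thesis by (simp add: deviation_freq_def)
qed

lemma card_index_pairs_pos: "0 < real (card (index_pairs n))"
proof -
  have "0 < real n * (real n - 1)" using two_le_n by simp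
  then show ?thesis using card_index_pairs[of n] by linarith
qed

text \<open>Chebyshev is applied pointwise: each indicator is at most a normalised square, and the
  sum of these squares over all sequences has the closed form of
  \<open>sum_lists_sum_list_sq\<close>. Expectations are taken only afterwards.\<close>

lemma deviation_freq_le:
  assumes "1 \<le> m" "0 < \<epsilon>"
  defines "L \<equiv> real (card (index_pairs n))"
  shows "deviation_freq n m X h \<epsilon> \<omega> \<le>
    (real m * L * (\<Sum>p\<in>index_pairs n. (centred_at p \<omega>)\<^sup>2)
      + real m * (real m - 1) * (\<Sum>p\<in>index_pairs n. centred_at p \<omega>)\<^sup>2) / (L\<^sup>2 * (real m)\<^sup>2 * \<epsilon>\<^sup>2)"
    (is "_ \<le> ?B / _")
proof -
  have L: "0 < L" unfolding L_def by (rule card_index_pairs_pos)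
  have "(\<Sum>J\<in>pair_seqs n m. deviates m \<epsilon> J (\<lambda>i. X i \<omega>))
      \<le> (\<Sum>J\<in>pair_seqs n m. (\<Sum>p\<leftarrow>J. centred_at p \<omega>)\<^sup>2 / ((real m)\<^sup>2 * \<epsilon>\<^sup>2))"
  proof (rule sum_mono)
    fix J
    show "deviates m \<epsilon> J (\<lambda>i. X i \<omega>) \<le> (\<Sum>p\<leftarrow>J. centred_at p \<omega>)\<^sup>2 / ((real m)\<^sup>2 * \<epsilon>\<^sup>2)"
      using of_bool_abs_ge_le_square[OF assms(2), of "(\<Sum>p\<leftarrow>J. centred_at p \<omega>) / real m"]
      by (simp add: deviates_def centred_at_def power_divide)
  qed
  also have "\<dots> = L ^ m * ?B / (L\<^sup>2 * (real m)\<^sup>2 * \<epsilon>\<^sup>2)"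
  proof -
    have "L\<^sup>2 * (\<Sum>J\<in>pair_seqs n m. (\<Sum>p\<leftarrow>J. centred_at p \<omega>)\<^sup>2) = L ^ m * ?B"
      using sum_lists_sum_list_sq[OF finite_index_pairs[of n], where m = m and d = "\<lambda>p. centred_at p \<omega>"]
      by (simp add: pair_seqs_def L_def)
    then have "(\<Sum>J\<in>pair_seqs n m. (\<Sum>p\<leftarrow>J. centred_at p \<omega>)\<^sup>2) = L ^ m * ?B / L\<^sup>2"
      using L by (simp add: eq_divide_eq mult.commute)
    then show ?thesis by (simp add: sum_divide_distrib[symmetric] mult.assoc)
  qed
  finally have "(\<Sum>J\<in>pair_seqs n m. deviates m \<epsilon> J (\<lambda>i. X i \<omega>)) / L ^ m
      \<le> L ^ m * ?B / (L\<^sup>2 * (real m)\<^sup>2 * \<epsilon>\<^sup>2) / L ^ m"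
    using L by (intro divide_right_mono) auto
  then show ?thesis
    using L by (simp add: deviation_freq_eq[OF assms(1)] card_pair_seqs L_def[symmetric])
qed

section \<open>Measurability and exchangeability\<close>

lemma deviates_meas:
  assumes "\<And>p. p \<in> set J \<Longrightarrow> fst p \<in> A \<and> snd p \<in> A"
  shows "deviates m \<epsilon> J \<in> borel_measurable (PiM A (\<lambda>_. Z))"
proof -
  have "(\<lambda>x. \<Sum>p\<leftarrow>J. centred (x (fst p), x (snd p))) \<in> borel_measurable (PiM A (\<lambda>_. Z))"
    using assms
  proof (induction J)
    case (Cons p J)
    then have [measurable]: "(\<lambda>x. x (fst p)) \<in> measurable (PiM A (\<lambda>_. Z)) Z"
      "(\<lambda>x. x (snd p)) \<in> measurable (PiM A (\<lambda>_. Z)) Z"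
      by (auto intro!: measurable_component_singleton)
    have [measurable]: "(\<lambda>x. \<Sum>p\<leftarrow>J. centred (x (fst p), x (snd p))) \<in> borel_measurable (PiM A (\<lambda>_. Z))"
      using Cons by simp
    show ?case by simp
  qed simp
  note [measurable] = this
  show ?thesis unfolding deviates_def[abs_def] by measurable
qed

lemma deviates_bounds: "0 \<le> deviates m \<epsilon> J x" "deviates m \<epsilon> J x \<le> 1"
  by (simp_all add: deviates_def)

lemma deviates_cong:
  assumes "\<And>p. p \<in> set J \<Longrightarrow> x (fst p) = y (fst p) \<and> x (snd p) = y (snd p)"
  shows "deviates m \<epsilon> J x = deviates m \<epsilon> J y"
  using assms by (simp add: deviates_def cong: map_cong)

lemma pair_seqs_in:
  assumes "J \<in> pair_seqs n m" "p \<in> set J"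
  shows "fst p \<in> {1..n}" "snd p \<in> {1..n}"
  using assms by (auto simp: pair_seqs_def index_pairs_def)

lemma deviates_permuted_meas:
  assumes J: "J \<in> pair_seqs n m" and \<psi>: "\<psi> permutes {1..n}"
  shows "(\<lambda>\<omega>. deviates m \<epsilon> J (\<lambda>i. X (\<psi> i) \<omega>)) \<in> borel_measurable P"
proof -
  have [measurable]: "deviates m \<epsilon> J \<in> borel_measurable (PiM {1..n} (\<lambda>_. Z))"
    using pair_seqs_in[OF J] by (intro deviates_meas) blast
  have [measurable]: "(\<lambda>\<omega>. \<lambda>i\<in>{1..n}. X (\<psi> i) \<omega>) \<in> measurable P (PiM {1..n} (\<lambda>_. Z))"
    using X_meas permutes_in_image[OF \<psi>] by (intro measurable_restrict) auto
  have "(\<lambda>\<omega>. deviates m \<epsilon> J (\<lambda>i\<in>{1..n}. X (\<psi> i) \<omega>)) \<in> borel_measurable P"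
    by measurable
  moreover have "deviates m \<epsilon> J (\<lambda>i\<in>{1..n}. X (\<psi> i) \<omega>) = deviates m \<epsilon> J (\<lambda>i. X (\<psi> i) \<omega>)" for \<omega>
    using pair_seqs_in[OF J] by (intro deviates_cong) auto
  ultimately show ?thesis by simp
qed

text \<open>Exchangeability: the unpermuted sample is distributed as a power of \<open>law\<close>,
  and such a power is invariant under reindexing its coordinates by a permutation. The restriction
  to \<open>{1..n}\<close> puts the samples into the product space.\<close>

lemma distr_permuted_sample:
  assumes \<psi>: "\<psi> permutes {1..n}"
  shows "distr P (PiM {1..n} (\<lambda>_. Z)) (\<lambda>\<omega>. \<lambda>i\<in>{1..n}. X (\<psi> i) \<omega>) = PiM {1..n} (\<lambda>_. law)"
proof -
  let ?S = "PiM {1..n} (\<lambda>_. Z)"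
  have ne: "{1..n} \<noteq> {}" using one_two_in by blast
  have "distr P ?S (\<lambda>\<omega>. \<lambda>i\<in>{1..n}. X i \<omega>) = PiM {1..n} (\<lambda>i. distr P Z (X i))"
    using indep_vars_iff_distr_eq_PiM'[OF ne X_meas] indep by simp
  also have "\<dots> = PiM {1..n} (\<lambda>_. law)"
    by (rule PiM_cong) (auto simp: distr_X)
  finally have base: "distr P ?S (\<lambda>\<omega>. \<lambda>i\<in>{1..n}. X i \<omega>) = PiM {1..n} (\<lambda>_. law)" .
  have [measurable]: "(\<lambda>\<omega>. \<lambda>i\<in>{1..n}. X i \<omega>) \<in> measurable P ?S"
    using X_meas by (intro measurable_restrict) auto
  have perm_meas [measurable]: "(\<lambda>x. \<lambda>i\<in>{1..n}. x (\<psi> i)) \<in> measurable ?S ?S"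
    using permutes_in_image[OF \<psi>] by (intro measurable_restrict measurable_component_singleton) auto
  have "distr P ?S (\<lambda>\<omega>. \<lambda>i\<in>{1..n}. X (\<psi> i) \<omega>)
      = distr (distr P ?S (\<lambda>\<omega>. \<lambda>i\<in>{1..n}. X i \<omega>)) ?S (\<lambda>x. \<lambda>i\<in>{1..n}. x (\<psi> i))"
  proof (subst distr_distr)
    show "distr P ?S (\<lambda>\<omega>. \<lambda>i\<in>{1..n}. X (\<psi> i) \<omega>)
      = distr P ?S ((\<lambda>x. \<lambda>i\<in>{1..n}. x (\<psi> i)) \<circ> (\<lambda>\<omega>. \<lambda>i\<in>{1..n}. X i \<omega>))"
      using permutes_in_image[OF \<psi>] by (intro distr_cong) (auto simp: fun_eq_iff)
  qed measurable
  also have "\<dots> = distr (PiM {1..n} (\<lambda>_. law)) (PiM {1..n} (\<lambda>_. law)) (\<lambda>x. \<lambda>i\<in>{1..n}. x (\<psi> i))"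
    unfolding base by (intro distr_cong sets_PiM_cong) auto
  also have "\<dots> = PiM {1..n} (\<lambda>_. law)"
    using permutes_in_image[OF \<psi>] permutes_inj_on[OF \<psi>]
    by (intro distr_PiM_reindex) (auto intro: law.prob_space_axioms)
  finally show ?thesis .
qed

lemma expectation_deviates_permuted:
  assumes J: "J \<in> pair_seqs n m" and \<psi>: "\<psi> permutes {1..n}"
  shows "expectation (\<lambda>\<omega>. deviates m \<epsilon> J (\<lambda>i. X (\<psi> i) \<omega>)) = expectation (\<lambda>\<omega>. deviates m \<epsilon> J (\<lambda>i. X i \<omega>))"
proof -
  have eq: "expectation (\<lambda>\<omega>. deviates m \<epsilon> J (\<lambda>i. X (\<phi> i) \<omega>)) = (\<integral>x. deviates m \<epsilon> J x \<partial>PiM {1..n} (\<lambda>_. law))"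
    if \<phi>: "\<phi> permutes {1..n}" for \<phi>
  proof -
    have "expectation (\<lambda>\<omega>. deviates m \<epsilon> J (\<lambda>i. X (\<phi> i) \<omega>)) = expectation (\<lambda>\<omega>. deviates m \<epsilon> J (\<lambda>i\<in>{1..n}. X (\<phi> i) \<omega>))"
      using pair_seqs_in[OF J] by (intro Bochner_Integration.integral_cong deviates_cong) auto
    also have "\<dots> = (\<integral>x. deviates m \<epsilon> J x \<partial>distr P (PiM {1..n} (\<lambda>_. Z)) (\<lambda>\<omega>. \<lambda>i\<in>{1..n}. X (\<phi> i) \<omega>))"
    proof (rule integral_distr[symmetric])
      show "(\<lambda>\<omega>. \<lambda>i\<in>{1..n}. X (\<phi> i) \<omega>) \<in> measurable P (PiM {1..n} (\<lambda>_. Z))"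
        using X_meas permutes_in_image[OF \<phi>] by (intro measurable_restrict) auto
      show "deviates m \<epsilon> J \<in> borel_measurable (PiM {1..n} (\<lambda>_. Z))"
        using pair_seqs_in[OF J] by (intro deviates_meas) blast
    qed
    finally show ?thesis unfolding distr_permuted_sample[OF \<phi>] .
  qed
  show ?thesis using eq[OF \<psi>] eq[OF permutes_id] by simp
qed

lemma deviation_freq_meas:
  assumes "1 \<le> m"
  shows "deviation_freq n m X h \<epsilon> \<in> borel_measurable P"
  unfolding deviation_freq_eq[OF assms, abs_def]
  using deviates_permuted_meas[OF _ permutes_id] by (auto intro!: borel_measurable_divide borel_measurable_sum)

lemma average_deviates_bounds:
  "0 \<le> (\<Sum>J\<in>pair_seqs n m. deviates m \<epsilon> J (f J)) / real (card (pair_seqs n m))"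
  "(\<Sum>J\<in>pair_seqs n m. deviates m \<epsilon> J (f J)) / real (card (pair_seqs n m)) \<le> 1"
proof -
  show "0 \<le> (\<Sum>J\<in>pair_seqs n m. deviates m \<epsilon> J (f J)) / real (card (pair_seqs n m))"
    by (intro divide_nonneg_nonneg sum_nonneg deviates_bounds) auto
  have "(\<Sum>J\<in>pair_seqs n m. deviates m \<epsilon> J (f J)) \<le> real (card (pair_seqs n m)) * 1"
    by (rule sum_bounded_above) (rule deviates_bounds)
  then show "(\<Sum>J\<in>pair_seqs n m. deviates m \<epsilon> J (f J)) / real (card (pair_seqs n m)) \<le> 1"
    by (simp add: divide_le_eq_1 card_gt_0_iff)
qed

lemma deviation_freq_bounds:
  assumes "1 \<le> m"
  shows "0 \<le> deviation_freq n m X h \<epsilon> \<omega>" "deviation_freq n m X h \<epsilon> \<omega> \<le> 1"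
  unfolding deviation_freq_eq[OF assms] by (rule average_deviates_bounds)+

lemma deviation_freq_integrable:
  assumes "1 \<le> m"
  shows "integrable P (deviation_freq n m X h \<epsilon>)"
  by (rule integrable_const_bound[of _ 1])
    (simp_all only: deviation_freq_meas[OF assms] deviation_freq_bounds[OF assms] real_norm_def abs_of_nonneg AE_I2)

lemma deviation_mean_le:
  assumes m: "1 \<le> m" "2 * m \<le> n" and \<epsilon>: "0 < \<epsilon>"
  shows "deviation_mean n m X h \<epsilon> \<le> sigma_star_sq m Z X h \<epsilon>"
proof -
  define L where "L = real (card (index_pairs n))"
  define v where "v = kernel_var X h"
  define w where "w = kernel_var1 Z X h"
  define Q where "Q \<omega> = (\<Sum>p\<in>index_pairs n. (centred_at p \<omega>)\<^sup>2)" for \<omega>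
  define D2 where "D2 \<omega> = (\<Sum>p\<in>index_pairs n. centred_at p \<omega>)\<^sup>2" for \<omega>
  have L: "0 < L" unfolding L_def by (rule card_index_pairs_pos)
  have vw: "0 \<le> v" "0 \<le> w" by (simp_all add: v_def w_def kernel_var_nonneg kernel_var1_nonneg)
  have Q: "integrable P Q" "expectation Q = L * v"
    by (simp_all add: Q_def[abs_def] L_def v_def centred_at_sq_integrable variance_centred_at)
  have D2: "integrable P D2"
    by (simp add: D2_def[abs_def] power2_eq_square sum_product centred_at_mult_integrable)
  have ED2: "expectation D2 \<le> L * (v + 2 * real n * w)"
    using sum_centred_at_second_moment_le by (simp add: D2_def[abs_def] L_def v_def w_def)
  have "deviation_mean n m X h \<epsilon> \<le>
      expectation (\<lambda>\<omega>. (real m * L * Q \<omega> + real m * (real m - 1) * D2 \<omega>) / (L\<^sup>2 * (real m)\<^sup>2 * \<epsilon>\<^sup>2))"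
    unfolding deviation_mean_def
  proof (rule integral_mono)
    fix \<omega>
    show "deviation_freq n m X h \<epsilon> \<omega> \<le> (real m * L * Q \<omega> + real m * (real m - 1) * D2 \<omega>) / (L\<^sup>2 * (real m)\<^sup>2 * \<epsilon>\<^sup>2)"
      using deviation_freq_le[OF m(1) \<epsilon>, of \<omega>] by (simp add: Q_def D2_def L_def)
  qed (use Q D2 in \<open>simp_all add: deviation_freq_integrable[OF m(1)]\<close>)
  also have "\<dots> = (real m * L * (L * v) + real m * (real m - 1) * expectation D2) / (L\<^sup>2 * (real m)\<^sup>2 * \<epsilon>\<^sup>2)"
    using Q D2 by simp
  also have "\<dots> \<le> (real m * L * (L * v) + real m * (real m - 1) * (L * (v + 2 * real n * w))) / (L\<^sup>2 * (real m)\<^sup>2 * \<epsilon>\<^sup>2)"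
    using m ED2 by (intro divide_right_mono add_left_mono mult_left_mono) auto
  also have "\<dots> = (L * v + (real m - 1) * (v + 2 * real n * w)) / (L * real m * \<epsilon>\<^sup>2)"
  proof -
    have "real m * L * (L * v) + real m * (real m - 1) * (L * (v + 2 * real n * w))
        = (L * real m) * (L * v + (real m - 1) * (v + 2 * real n * w))"
      by (simp add: algebra_simps)
    moreover have "L\<^sup>2 * (real m)\<^sup>2 * \<epsilon>\<^sup>2 = (L * real m) * (L * real m * \<epsilon>\<^sup>2)"
      by (simp add: power2_eq_square)
    moreover have "L * real m \<noteq> 0" using L m by simp
    ultimately show ?thesis by (simp only: mult_divide_mult_cancel_left[OF \<open>L * real m \<noteq> 0\<close>])
  qed
  also have "\<dots> \<le> L * (2 * v + 2 * w) / (L * real m * \<epsilon>\<^sup>2)"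
  proof (rule divide_right_mono)
    \<comment> \<open>It remains to see
      \<open>(real m - 1) * (v + 2 * real n * w) \<le> L * (v + 2 * w)\<close>. For this it suffices
      that \<open>(real m - 1) * real n \<le> L\<close>, which follows from
      \<open>n \<ge> 2 * m\<close> because \<open>2 * L = real n * (real n - 1)\<close>.\<close>
    have "real (2 * m) \<le> real n" using m(2) by (simp only: of_nat_le_iff)
    then have "2 * (real m - 1) \<le> real n - 2" by simp
    have n: "2 \<le> real n" using two_le_n by simp
    have LL: "2 * L = real n * (real n - 1)" unfolding L_def by (rule card_index_pairs)
    have "2 * (real m - 1) * real n \<le> (real n - 1) * real n"
      using \<open>2 * (real m - 1) \<le> real n - 2\<close> by (intro mult_right_mono) auto
    then have 1: "(real m - 1) * real n \<le> L" using LL by (simp add: algebra_simps)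
    have "(real m - 1) * 1 \<le> (real m - 1) * real n" using n m by (intro mult_left_mono) auto
    then have 2: "real m - 1 \<le> L" using 1 by simp
    have "(real m - 1) * v \<le> L * v" "(real m - 1) * real n * w \<le> L * w"
      using 1 2 vw by (intro mult_right_mono; simp)+
    then show "L * v + (real m - 1) * (v + 2 * real n * w) \<le> L * (2 * v + 2 * w)"
      by (simp add: algebra_simps)
  qed (use L in simp)
  also have "\<dots> = sigma_star_sq m Z X h \<epsilon>"
    using L by (simp add: sigma_star_sq_def v_def w_def)
  finally show ?thesis .
qed

subsection \<open>Averaging over permutations\<close>

text \<open>A permutation of the sample acts on index pairs by mapping both entries and sorting the
  result. Sorting is harmless by symmetry of the kernel, and the action is injective, so applied
  entrywise it permutes the finite set of sequences.\<close>

lemma sum_deviates_permuted: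
  assumes \<pi>: "\<pi> permutes {1..n}" and \<omega>: "\<omega> \<in> space P"
  shows "(\<Sum>J\<in>pair_seqs n m. deviates m \<epsilon> J (\<lambda>i. X (\<pi> i) \<omega>)) = (\<Sum>J\<in>pair_seqs n m. deviates m \<epsilon> J (\<lambda>i. X i \<omega>))"
proof -
  define \<sigma> where "\<sigma> p = (min (\<pi> (fst p)) (\<pi> (snd p)), max (\<pi> (fst p)) (\<pi> (snd p)))" for p
  have inj: "\<pi> i = \<pi> j \<longleftrightarrow> i = j" for i j
    using permutes_inj[OF \<pi>] by (auto dest: injD)
  have in_n: "\<pi> i \<in> {1..n} \<longleftrightarrow> i \<in> {1..n}" for i
    by (rule permutes_in_image[OF \<pi>])
  have \<sigma>_into: "\<sigma> p \<in> index_pairs n" if "p \<in> index_pairs n" for p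
  proof -
    have "fst p \<in> {1..n}" "snd p \<in> {1..n}" "fst p \<noteq> snd p"
      using that by (auto simp: index_pairs_def)
    then have "\<pi> (fst p) \<in> {1..n}" "\<pi> (snd p) \<in> {1..n}" "\<pi> (fst p) \<noteq> \<pi> (snd p)"
      by (simp_all only: in_n inj not_False_eq_True)
    then show ?thesis by (auto simp: \<sigma>_def index_pairs_def min_def max_def)
  qed
  have \<sigma>_inj: "inj_on \<sigma> (index_pairs n)"
  proof (rule inj_onI)
    fix p q assume pq: "p \<in> index_pairs n" "q \<in> index_pairs n" "\<sigma> p = \<sigma> q"
    have "{\<pi> (fst p), \<pi> (snd p)} = {\<pi> (fst q), \<pi> (snd q)}"
      using pq(3) by (auto simp: \<sigma>_def min_def max_def split: if_splits)
    then have "{fst p, snd p} = {fst q, snd q}" by (auto simp: doubleton_eq_iff inj)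
    then show "p = q" using pq(1,2) by (auto simp: index_pairs_def doubleton_eq_iff)
  qed
  have maps: "map \<sigma> ` pair_seqs n m \<subseteq> pair_seqs n m"
    using \<sigma>_into unfolding pair_seqs_def by fastforce
  have "inj_on (map \<sigma>) (pair_seqs n m)"
    by (rule inj_onI, rule map_inj_on, assumption, rule inj_on_subset[OF \<sigma>_inj])
      (auto simp: pair_seqs_def)
  then have bij: "bij_betw (map \<sigma>) (pair_seqs n m) (pair_seqs n m)"
    using endo_inj_surj[OF finite_pair_seqs maps] by (simp add: bij_betw_def)
  have "deviates m \<epsilon> (map \<sigma> J) (\<lambda>i. X i \<omega>) = deviates m \<epsilon> J (\<lambda>i. X (\<pi> i) \<omega>)" if J: "J \<in> pair_seqs n m" for J
  proof -
    have "centred (X (fst (\<sigma> p)) \<omega>, X (snd (\<sigma> p)) \<omega>) = centred (X (\<pi> (fst p)) \<omega>, X (\<pi> (snd p)) \<omega>)"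
      if "p \<in> set J" for p
    proof -
      have "\<pi> (fst p) \<in> {1..n}" "\<pi> (snd p) \<in> {1..n}"
        using pair_seqs_in[OF J that] by (simp_all only: in_n)
      from centred_X_commute[OF this \<omega>] show ?thesis by (simp add: \<sigma>_def min_def max_def)
    qed
    then show ?thesis by (simp add: deviates_def comp_def cong: map_cong)
  qed
  then show ?thesis
    using sum.reindex_bij_betw[OF bij, of "\<lambda>J. deviates m \<epsilon> J (\<lambda>i. X i \<omega>)"] by simp
qed

text \<open>A relabelling of the sample becomes a relabelling of the list, to which
  \<open>deviates_meas\<close> applies. The new pairs may be decreasing, which
  \<open>deviates\<close> allows.\<close>

lemma deviates_map:
  "deviates m \<epsilon> J (\<lambda>i. x (f i)) = deviates m \<epsilon> (map (\<lambda>p. (f (fst p), f (snd p))) J) x"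
  by (simp add: deviates_def comp_def)

text \<open>\<open>placed_freq\<close> plays the part of a U-statistic kernel of \<open>2 m\<close> arguments, one block of the sample:
  every sequence \<open>J\<close> involves at most \<open>2 m\<close> indices, so a permutation \<open>\<phi> J\<close> can move all of them
  into the block. Averaging over all permutations \<open>\<pi>\<close> of the sample undoes \<open>\<phi> J\<close>.\<close>

definition block :: "nat \<Rightarrow> nat \<Rightarrow> nat set" where
  "block m b = {2 * m * b <.. 2 * m * Suc b}"

definition places :: "nat \<Rightarrow> nat \<Rightarrow> ((nat \<times> nat) list \<Rightarrow> nat \<Rightarrow> nat) \<Rightarrow> bool" where
  "places m b \<phi> \<longleftrightarrow> (\<forall>J\<in>pair_seqs n m. \<phi> J permutes {1..n} \<and>
     (\<forall>p\<in>set J. \<phi> J (fst p) \<in> block m b \<and> \<phi> J (snd p) \<in> block m b))"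

definition placed_freq ::
  "nat \<Rightarrow> real \<Rightarrow> ((nat \<times> nat) list \<Rightarrow> nat \<Rightarrow> nat) \<Rightarrow> (nat \<Rightarrow> 'z) \<Rightarrow> real" where
  "placed_freq m \<epsilon> \<phi> x =
     (\<Sum>J\<in>pair_seqs n m. deviates m \<epsilon> J (\<lambda>i. x (\<phi> J i))) / real (card (pair_seqs n m))"

text \<open>The intervals are open on the left so that block 0 starts at index 1, the first of the
  sample.\<close>

lemma block_subset: "b < n div (2 * m) \<Longrightarrow> block m b \<subseteq> {1..n}"
proof -
  assume "b < n div (2 * m)"
  then have "2 * m * Suc b \<le> 2 * m * (n div (2 * m))" by (intro mult_le_mono2) simp
  also have "\<dots> \<le> n" by simp
  finally show ?thesis by (auto simp: block_def)
qed

lemma block_disjoint: "b < c \<Longrightarrow> block m b \<inter> block m c = {}"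
proof -
  assume "b < c"
  then have "2 * m * Suc b \<le> 2 * m * c" by (intro mult_le_mono2) simp
  then show ?thesis by (auto simp: block_def)
qed

lemma ex_places:
  assumes "b < n div (2 * m)"
  shows "\<exists>\<phi>. places m b \<phi>"
proof -
  have "\<exists>p. p permutes {1..n} \<and> (\<forall>q\<in>set J. p (fst q) \<in> block m b \<and> p (snd q) \<in> block m b)"
    if J: "J \<in> pair_seqs n m" for J
  proof -
    let ?V = "fst ` set J \<union> snd ` set J"
    have "card ?V \<le> card (fst ` set J) + card (snd ` set J)" by (rule card_Un_le)
    also have "\<dots> \<le> card (set J) + card (set J)" by (intro add_mono card_image_le) auto
    also have "\<dots> \<le> 2 * m" using J card_length[of J] by (auto simp: pair_seqs_def)
    finally have "card ?V \<le> card (block m b)" by (simp add: block_def)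
    moreover have "?V \<subseteq> {1..n}" using pair_seqs_in[OF J] by blast
    ultimately obtain p where "p permutes {1..n}" "p ` ?V \<subseteq> block m b"
      using ex_permutes_into[OF _ _ block_subset[OF assms]] by blast
    then show ?thesis by blast
  qed
  then show ?thesis unfolding places_def by metis
qed

text \<open>Two invariances combine. After exchanging the sums, composing with the fixed permutation
  \<open>\<phi> J\<close> only reorders the sum over \<open>\<pi>\<close>; after exchanging back,
  the sum over sequences does not depend on \<open>\<pi>\<close> by
  \<open>sum_deviates_permuted\<close>.\<close>

lemma deviation_freq_eq_average_placed:
  assumes "1 \<le> m" and \<phi>: "places m b \<phi>" and \<omega>: "\<omega> \<in> space P"
  shows "(\<Sum>\<pi> | \<pi> permutes {1..n}. placed_freq m \<epsilon> \<phi> (\<lambda>i. X (\<pi> i) \<omega>)) = fact n * deviation_freq n m X h \<epsilon> \<omega>"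
proof -
  let ?N = "real (card (pair_seqs n m))"
  have "(\<Sum>\<pi> | \<pi> permutes {1..n}. placed_freq m \<epsilon> \<phi> (\<lambda>i. X (\<pi> i) \<omega>))
      = (\<Sum>J\<in>pair_seqs n m. \<Sum>\<pi> | \<pi> permutes {1..n}. deviates m \<epsilon> J (\<lambda>i. X ((\<pi> \<circ> \<phi> J) i) \<omega>)) / ?N"
    unfolding placed_freq_def sum_divide_distrib[symmetric] o_apply by (subst sum.swap) (rule refl)
  also have "(\<Sum>J\<in>pair_seqs n m. \<Sum>\<pi> | \<pi> permutes {1..n}. deviates m \<epsilon> J (\<lambda>i. X ((\<pi> \<circ> \<phi> J) i) \<omega>))
      = (\<Sum>J\<in>pair_seqs n m. \<Sum>\<pi> | \<pi> permutes {1..n}. deviates m \<epsilon> J (\<lambda>i. X (\<pi> i) \<omega>))"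
  proof (rule sum.cong[OF refl])
    fix J assume "J \<in> pair_seqs n m"
    then have "\<phi> J permutes {1..n}" using \<phi> by (simp add: places_def)
    from sum_permutations_compose_right[OF this, of "\<lambda>\<pi>. deviates m \<epsilon> J (\<lambda>i. X (\<pi> i) \<omega>)"]
    show "(\<Sum>\<pi> | \<pi> permutes {1..n}. deviates m \<epsilon> J (\<lambda>i. X ((\<pi> \<circ> \<phi> J) i) \<omega>))
      = (\<Sum>\<pi> | \<pi> permutes {1..n}. deviates m \<epsilon> J (\<lambda>i. X (\<pi> i) \<omega>))" by simp
  qed
  also have "\<dots> = (\<Sum>\<pi> | \<pi> permutes {1..n}. \<Sum>J\<in>pair_seqs n m. deviates m \<epsilon> J (\<lambda>i. X (\<pi> i) \<omega>))"
    by (rule sum.swap)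
  also have "\<dots> = (\<Sum>\<pi> | \<pi> permutes {1..n}. \<Sum>J\<in>pair_seqs n m. deviates m \<epsilon> J (\<lambda>i. X i \<omega>))"
    by (rule sum.cong) (simp_all add: sum_deviates_permuted[OF _ \<omega>])
  also have "\<dots> = fact n * (\<Sum>J\<in>pair_seqs n m. deviates m \<epsilon> J (\<lambda>i. X i \<omega>))"
    by (simp add: card_permutations[of _ n])
  finally show ?thesis by (simp add: deviation_freq_eq[OF assms(1)])
qed

lemma placed_freq_bounds: "0 \<le> placed_freq m \<epsilon> \<phi> x" "placed_freq m \<epsilon> \<phi> x \<le> 1"
  unfolding placed_freq_def by (rule average_deviates_bounds)+

section \<open>One block under a fixed permutation of the sample\<close>

context
  fixes m b :: nat and \<phi> and \<pi> :: "nat \<Rightarrow> nat"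
  assumes \<phi>: "places m b \<phi>" and \<pi>: "\<pi> permutes {1..n}"
begin

lemma placed_freq_meas:
  "(\<lambda>x. placed_freq m \<epsilon> \<phi> (\<lambda>i. x (\<pi> i))) \<in> borel_measurable (PiM (\<pi> ` block m b) (\<lambda>_. Z))"
proof -
  have [measurable]: "(\<lambda>x. deviates m \<epsilon> J (\<lambda>i. x (\<pi> (\<phi> J i)))) \<in> borel_measurable (PiM (\<pi> ` block m b) (\<lambda>_. Z))"
    if "J \<in> pair_seqs n m" for J
  proof -
    have "(\<lambda>x. deviates m \<epsilon> J (\<lambda>i. x (\<pi> (\<phi> J i))))
        = deviates m \<epsilon> (map (\<lambda>p. (\<pi> (\<phi> J (fst p)), \<pi> (\<phi> J (snd p)))) J)"
      by (rule ext) (rule deviates_map)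
    then show ?thesis
      using that \<phi> by (fastforce simp: places_def intro!: deviates_meas)
  qed
  show ?thesis unfolding placed_freq_def by measurable
qed

text \<open>Only the sample points in the image of the block are consulted. This exhibits
  \<open>placed_freq\<close> as a function of the restricted sample, the form in which independence
  of blocks is available.\<close>

lemma placed_freq_restrict:
  "placed_freq m \<epsilon> \<phi> (\<lambda>i. (\<lambda>l\<in>\<pi> ` block m b. X l \<omega>) (\<pi> i)) = placed_freq m \<epsilon> \<phi> (\<lambda>i. X (\<pi> i) \<omega>)"
  unfolding placed_freq_def using \<phi>
  by (intro arg_cong2[of _ _ _ _ "(/)"] sum.cong refl deviates_cong) (auto simp: places_def)

lemma placed_deviates_meas:
  assumes "J \<in> pair_seqs n m"
  shows "(\<lambda>\<omega>. deviates m \<epsilon> J (\<lambda>i. X (\<pi> (\<phi> J i)) \<omega>)) \<in> borel_measurable P"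
    and "expectation (\<lambda>\<omega>. deviates m \<epsilon> J (\<lambda>i. X (\<pi> (\<phi> J i)) \<omega>)) = expectation (\<lambda>\<omega>. deviates m \<epsilon> J (\<lambda>i. X i \<omega>))"
proof -
  have "\<pi> \<circ> \<phi> J permutes {1..n}"
    using assms \<phi> \<pi> by (auto simp: places_def intro: permutes_compose)
  from deviates_permuted_meas[OF assms this] expectation_deviates_permuted[OF assms this]
  show "(\<lambda>\<omega>. deviates m \<epsilon> J (\<lambda>i. X (\<pi> (\<phi> J i)) \<omega>)) \<in> borel_measurable P"
    and "expectation (\<lambda>\<omega>. deviates m \<epsilon> J (\<lambda>i. X (\<pi> (\<phi> J i)) \<omega>)) = expectation (\<lambda>\<omega>. deviates m \<epsilon> J (\<lambda>i. X i \<omega>))"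
    by (simp_all add: comp_def)
qed

lemma placed_freq_X_meas: "(\<lambda>\<omega>. placed_freq m \<epsilon> \<phi> (\<lambda>i. X (\<pi> i) \<omega>)) \<in> borel_measurable P"
  unfolding placed_freq_def
  by (intro borel_measurable_divide borel_measurable_sum borel_measurable_const placed_deviates_meas)

text \<open>The summand for \<open>J\<close> sees the sample through
  \<open>\<pi> \<circ> \<phi> J\<close>, a permutation that depends on \<open>J\<close>.
  Exchangeability is thus applied to each summand separately, and linearity does the rest.\<close>

lemma expectation_placed_freq:
  assumes m: "1 \<le> m"
  shows "expectation (\<lambda>\<omega>. placed_freq m \<epsilon> \<phi> (\<lambda>i. X (\<pi> i) \<omega>)) = deviation_mean n m X h \<epsilon>"
proof -
  have int: "integrable P (\<lambda>\<omega>. deviates m \<epsilon> J (\<lambda>i. X (\<pi> (\<phi> J i)) \<omega>))"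
    "integrable P (\<lambda>\<omega>. deviates m \<epsilon> J (\<lambda>i. X i \<omega>))" if "J \<in> pair_seqs n m" for J
    using placed_deviates_meas(1)[OF that] deviates_permuted_meas[OF that permutes_id]
    by (auto intro!: integrable_const_bound[of _ 1] simp: deviates_bounds abs_of_nonneg)
  show ?thesis
    unfolding deviation_mean_def deviation_freq_eq[OF m, abs_def] placed_freq_def
    using int by (simp add: placed_deviates_meas(2))
qed

lemma mgf_placed_freq_le:
  assumes "1 \<le> m" "0 < l"
  shows "integrable P (\<lambda>\<omega>. exp (l * placed_freq m \<epsilon> \<phi> (\<lambda>i. X (\<pi> i) \<omega>)))"
    and "expectation (\<lambda>\<omega>. exp (l * placed_freq m \<epsilon> \<phi> (\<lambda>i. X (\<pi> i) \<omega>)))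
      \<le> exp (deviation_mean n m X h \<epsilon> * (exp l - 1))"
proof -
  let ?G = "\<lambda>\<omega>. placed_freq m \<epsilon> \<phi> (\<lambda>i. X (\<pi> i) \<omega>)"
  note [measurable] = placed_freq_X_meas
  have G: "integrable P ?G"
    by (rule integrable_const_bound[of _ 1]) (auto simp: placed_freq_bounds abs_of_nonneg)
  show int: "integrable P (\<lambda>\<omega>. exp (l * ?G \<omega>))"
    by (rule integrable_const_bound[of _ "exp l"])
      (use assms(2) in \<open>auto simp: placed_freq_bounds mult_le_cancel_left1\<close>)
  have "expectation (\<lambda>\<omega>. exp (l * ?G \<omega>)) \<le> expectation (\<lambda>\<omega>. 1 + ?G \<omega> * (exp l - 1))"
    by (rule integral_mono) (use int G in \<open>auto intro!: exp_le_affine placed_freq_bounds\<close>)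
  also have "\<dots> = 1 + deviation_mean n m X h \<epsilon> * (exp l - 1)"
    using G expectation_placed_freq[OF assms(1)] by (simp add: prob_space)
  also have "\<dots> \<le> exp (deviation_mean n m X h \<epsilon> * (exp l - 1))"
    by (rule exp_ge_add_one_self)
  finally show "expectation (\<lambda>\<omega>. exp (l * ?G \<omega>)) \<le> exp (deviation_mean n m X h \<epsilon> * (exp l - 1))" .
qed

end

text \<open>For a fixed \<open>\<pi>\<close> the images of the blocks are still disjoint, so the
  \<open>k\<close> placed frequencies depend on independent parts of the sample and the moment
  generating function of their sum factorises.\<close>

lemma mgf_block_sum_le:
  fixes \<epsilon> :: real
  assumes m: "1 \<le> m" and l: "0 < l" and k: "k = n div (2 * m)"
    and \<phi>: "\<And>b. b < k \<Longrightarrow> places m b (\<phi> b)" and \<pi>: "\<pi> permutes {1..n}"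
  defines "S \<equiv> \<lambda>\<omega>. \<Sum>b<k. placed_freq m \<epsilon> (\<phi> b) (\<lambda>i. X (\<pi> i) \<omega>)"
  shows "integrable P (\<lambda>\<omega>. exp (l * S \<omega>))"
    and "expectation (\<lambda>\<omega>. exp (l * S \<omega>)) \<le> exp (real k * (deviation_mean n m X h \<epsilon> * (exp l - 1)))"
proof -
  let ?G = "\<lambda>b \<omega>. exp (l * placed_freq m \<epsilon> (\<phi> b) (\<lambda>i. X (\<pi> i) \<omega>))"
  have expS: "exp (l * S \<omega>) = (\<Prod>b<k. ?G b \<omega>)" for \<omega>
    by (simp add: S_def sum_distrib_left exp_sum)
  have "indep_vars (\<lambda>b. PiM (\<pi> ` block m b) (\<lambda>_. Z)) (\<lambda>b \<omega>. \<lambda>i\<in>\<pi> ` block m b. X i \<omega>) {..<k}"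
  proof (rule indep_vars_restrict[OF indep])
    show "\<pi> ` block m b \<subseteq> {1..n}" if "b \<in> {..<k}" for b
      using that block_subset[of b m] k permutes_image[OF \<pi>] by blast
    show "disjoint_family_on (\<lambda>b. \<pi> ` block m b) {..<k}"
      unfolding disjoint_family_on_def
    proof (intro ballI impI)
      fix b c :: nat assume "b \<noteq> c"
      then have "block m b \<inter> block m c = {}"
        using block_disjoint[of b c m] block_disjoint[of c b m] by (cases "b < c") auto
      then show "\<pi> ` block m b \<inter> \<pi> ` block m c = {}"
        using permutes_inj[OF \<pi>] by (simp add: image_Int[symmetric])
    qed
  qed
  then have "indep_vars (\<lambda>_. borel)
      (\<lambda>b \<omega>. exp (l * placed_freq m \<epsilon> (\<phi> b) (\<lambda>i. (\<lambda>l\<in>\<pi> ` block m b. X l \<omega>) (\<pi> i)))) {..<k}"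
  proof (rule indep_vars_compose2)
    fix b assume "b \<in> {..<k}"
    then have [measurable]:
      "(\<lambda>x. placed_freq m \<epsilon> (\<phi> b) (\<lambda>i. x (\<pi> i))) \<in> borel_measurable (PiM (\<pi> ` block m b) (\<lambda>_. Z))"
      by (intro placed_freq_meas \<phi> \<pi>) auto
    show "(\<lambda>x. exp (l * placed_freq m \<epsilon> (\<phi> b) (\<lambda>i. x (\<pi> i)))) \<in> borel_measurable (PiM (\<pi> ` block m b) (\<lambda>_. Z))"
      by measurable
  qed
  then have indepG: "indep_vars (\<lambda>_. borel) ?G {..<k}"
    by (rule indep_vars_cong[THEN iffD1, rotated -1])
      (simp_all only: placed_freq_restrict[OF \<phi> \<pi>] lessThan_iff)
  have intG: "integrable P (?G b)" if "b \<in> {..<k}" for b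
    using that mgf_placed_freq_le(1)[OF \<phi> \<pi> m l] by simp
  show "integrable P (\<lambda>\<omega>. exp (l * S \<omega>))"
    unfolding expS by (rule indep_vars_integrable[OF _ indepG intG]) auto
  have "expectation (\<lambda>\<omega>. exp (l * S \<omega>)) = (\<Prod>b<k. expectation (?G b))"
    unfolding expS by (rule indep_vars_lebesgue_integral[OF _ indepG intG]) auto
  also have "\<dots> \<le> (\<Prod>b<k. exp (deviation_mean n m X h \<epsilon> * (exp l - 1)))"
    by (intro prod_mono conjI mgf_placed_freq_le(2)[OF \<phi> \<pi> m l]) auto
  also have "\<dots> = exp (real k * (deviation_mean n m X h \<epsilon> * (exp l - 1)))"
    by (simp add: exp_of_nat_mult)
  finally show "expectation (\<lambda>\<omega>. exp (l * S \<omega>)) \<le> exp (real k * (deviation_mean n m X h \<epsilon> * (exp l - 1)))" .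
qed

lemma mgf_deviation_freq_le:
  assumes m: "1 \<le> m" and l: "0 < l"
  defines "k \<equiv> n div (2 * m)"
  shows "integrable P (\<lambda>\<omega>. exp (l * real k * deviation_freq n m X h \<epsilon> \<omega>))"
    and "expectation (\<lambda>\<omega>. exp (l * real k * deviation_freq n m X h \<epsilon> \<omega>))
      \<le> exp (real k * (deviation_mean n m X h \<epsilon> * (exp l - 1)))"
proof -
  have "\<forall>b\<in>{..<k}. \<exists>\<phi>. places m b \<phi>" using ex_places by (simp add: k_def)
  then obtain \<phi> where "\<forall>b\<in>{..<k}. places m b (\<phi> b)" by (rule bchoice[THEN exE])
  then have \<phi>: "places m b (\<phi> b)" if "b < k" for b using that by simp
  let ?S = "\<lambda>\<pi> \<omega>. \<Sum>b<k. placed_freq m \<epsilon> (\<phi> b) (\<lambda>i. X (\<pi> i) \<omega>)"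
  let ?\<Pi> = "{\<pi>. \<pi> permutes {1..n}}"
  let ?W = "deviation_freq n m X h \<epsilon>"
  have fin: "finite ?\<Pi>" by (rule finite_permutations) simp
  have card: "card ?\<Pi> = fact n" by (rule card_permutations) auto
  have ne: "?\<Pi> \<noteq> {}" using permutes_id by blast
  note [measurable] = deviation_freq_meas[OF m]
  show int: "integrable P (\<lambda>\<omega>. exp (l * real k * ?W \<omega>))"
  proof (rule integrable_const_bound[of _ "exp (l * real k)"])
    show "AE \<omega> in P. norm (exp (l * real k * ?W \<omega>)) \<le> exp (l * real k)"
      using l deviation_freq_bounds(2)[OF m] by (intro AE_I2) (simp add: mult_left_le)
  qed measurable
  have intS: "integrable P (\<lambda>\<omega>. exp (l * ?S \<pi> \<omega>))"
    and mgfS: "expectation (\<lambda>\<omega>. exp (l * ?S \<pi> \<omega>)) \<le> exp (real k * (deviation_mean n m X h \<epsilon> * (exp l - 1)))"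
    if "\<pi> \<in> ?\<Pi>" for \<pi>
    using mgf_block_sum_le[OF m l k_def[THEN meta_eq_to_obj_eq] \<phi>, of \<pi>] that by auto
  have "expectation (\<lambda>\<omega>. exp (l * real k * ?W \<omega>)) \<le> expectation (\<lambda>\<omega>. \<Sum>\<pi>\<in>?\<Pi>. 1 / fact n * exp (l * ?S \<pi> \<omega>))"
  proof (rule integral_mono)
    fix \<omega> assume \<omega>: "\<omega> \<in> space P"
    have "(\<Sum>\<pi>\<in>?\<Pi>. ?S \<pi> \<omega>) = (\<Sum>b<k. \<Sum>\<pi>\<in>?\<Pi>. placed_freq m \<epsilon> (\<phi> b) (\<lambda>i. X (\<pi> i) \<omega>))"
      by (rule sum.swap)
    also have "\<dots> = real k * (fact n * ?W \<omega>)"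
      using deviation_freq_eq_average_placed[OF m \<phi> \<omega>] by simp
    \<comment> \<open>The exponent is now a convex combination with weights
      \<open>1 / fact n\<close>. Jensen needs no independence between different
      permutations.\<close>
    finally have "l * real k * ?W \<omega> = (\<Sum>\<pi>\<in>?\<Pi>. (1 / fact n) *\<^sub>R (l * ?S \<pi> \<omega>))"
      by (simp add: sum_distrib_left[symmetric] sum_divide_distrib[symmetric])
    then show "exp (l * real k * ?W \<omega>) \<le> (\<Sum>\<pi>\<in>?\<Pi>. 1 / fact n * exp (l * ?S \<pi> \<omega>))"
      using convex_on_sum[OF fin ne exp_convex, of "\<lambda>_. 1 / fact n" "\<lambda>\<pi>. l * ?S \<pi> \<omega>"] card
      by simp
  qed (use int intS in auto)
  also have "\<dots> = (\<Sum>\<pi>\<in>?\<Pi>. 1 / fact n * expectation (\<lambda>\<omega>. exp (l * ?S \<pi> \<omega>)))"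
    using intS by (subst Bochner_Integration.integral_sum) auto
  also have "\<dots> \<le> (\<Sum>\<pi>\<in>?\<Pi>. 1 / fact n * exp (real k * (deviation_mean n m X h \<epsilon> * (exp l - 1))))"
    using mgfS by (intro sum_mono mult_left_mono) auto
  also have "\<dots> = exp (real k * (deviation_mean n m X h \<epsilon> * (exp l - 1)))"
    using card by simp
  finally show "expectation (\<lambda>\<omega>. exp (l * real k * ?W \<omega>))
      \<le> exp (real k * (deviation_mean n m X h \<epsilon> * (exp l - 1)))" .
qed

section \<open>The tail bound\<close>

lemma deviation_freq_tail_le:
  assumes m: "1 \<le> m" "2 * m \<le> n" and \<epsilon>: "0 < \<epsilon>" and t: "0 < t"
  shows "prob {\<omega> \<in> space P. t \<le> deviation_freq n m X h \<epsilon> \<omega> - deviation_mean n m X h \<epsilon>}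
    \<le> exp (- (real n * t\<^sup>2) / (8 * real m * (sigma_star_sq m Z X h \<epsilon> + t / 3)))"
proof -
  let ?W = "deviation_freq n m X h \<epsilon>"
  define q where "q = deviation_mean n m X h \<epsilon>"
  define s where "s = sigma_star_sq m Z X h \<epsilon>"
  define k where "k = n div (2 * m)"
  have s: "0 \<le> s"
    unfolding s_def sigma_star_sq_def using kernel_var_nonneg kernel_var1_nonneg by simp
  have qs: "q \<le> s" unfolding q_def s_def by (rule deviation_mean_le[OF m \<epsilon>])
  have "0 < k" using m by (simp add: k_def div_greater_zero_iff)
  \<comment> \<open>Rounding down costs at most a factor 2, since \<open>Suc k \<le> 2 * k\<close>
    for positive \<open>k\<close>. The resulting \<open>4 * m\<close> times the 2 of the Bernstein
    exponent is the constant 8.\<close>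
  have "n < 2 * m * Suc k"
    using m dividend_less_times_div[of "2 * m" n] by (simp add: k_def)
  also have "\<dots> \<le> 4 * m * k" using \<open>0 < k\<close> by (cases k) auto
  finally have nk: "real n \<le> 4 * real m * real k"
    by (metis less_imp_le of_nat_le_iff of_nat_mult of_nat_numeral)
  obtain l where l: "0 < l" "s * (exp l - 1 - l) - l * t \<le> - t\<^sup>2 / (2 * (s + t / 3))"
    using bernstein_exponent[OF s t] .
  \<comment> \<open>The Chernoff parameter is \<open>l * real k\<close>, because the moment bound
    concerns a sum of \<open>k\<close> independent terms while \<open>?W\<close> is on the scale of
    their mean.\<close>
  have "prob {\<omega> \<in> space P. t + q \<le> ?W \<omega>} \<le> exp (- (l * real k) * (t + q)) * (\<integral>\<omega>\<in>space P. exp (l * real k * ?W \<omega>) \<partial>P)"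
  proof (rule Chernoff_ineq_ge)
    show "set_integrable P (space P) (\<lambda>\<omega>. exp (l * real k * ?W \<omega>))"
      unfolding set_integrable_def k_def
      by (rule integrable_mult_indicator[OF sets.top mgf_deviation_freq_le(1)[OF m(1) l(1)]])
  qed (use l \<open>0 < k\<close> in auto)
  also have "(\<integral>\<omega>\<in>space P. exp (l * real k * ?W \<omega>) \<partial>P) = expectation (\<lambda>\<omega>. exp (l * real k * ?W \<omega>))"
    by (rule set_integral_space) (rule mgf_deviation_freq_le(1)[OF m(1) l(1), folded k_def])
  also have "\<dots> \<le> exp (real k * (q * (exp l - 1)))"
    unfolding q_def k_def by (rule mgf_deviation_freq_le(2)[OF m(1) l(1)])
  finally have "prob {\<omega> \<in> space P. t + q \<le> ?W \<omega>} \<le> exp (- (l * real k) * (t + q)) * exp (real k * (q * (exp l - 1)))"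
    by simp
  also have "\<dots> = exp (real k * (q * (exp l - 1 - l) - l * t))"
    by (simp add: exp_add[symmetric] algebra_simps)
  \<comment> \<open>Centring has turned the coefficient of \<open>q\<close> into
    \<open>exp l - 1 - l\<close>, which is nonnegative. Only in this form is the exponent increasing
    in \<open>q\<close>, so that \<open>s\<close> may replace it.\<close>
  also have "\<dots> \<le> exp (real k * (- t\<^sup>2 / (2 * (s + t / 3))))"
  proof -
    have "q * (exp l - 1 - l) \<le> s * (exp l - 1 - l)"
      by (rule mult_right_mono[OF qs]) (use exp_ge_add_one_self[of l] in linarith)
    then have "q * (exp l - 1 - l) - l * t \<le> - t\<^sup>2 / (2 * (s + t / 3))" using l(2) by linarith
    then show ?thesis unfolding exp_le_cancel_iff by (rule mult_left_mono) simp
  qed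
  also have "\<dots> \<le> exp (- (real n * t\<^sup>2) / (8 * real m * (s + t / 3)))"
  proof -
    have pos: "0 < s + t / 3" using s t by simp
    have "real n * t\<^sup>2 / (8 * real m * (s + t / 3)) \<le> 4 * real m * real k * t\<^sup>2 / (8 * real m * (s + t / 3))"
      using nk pos by (intro divide_right_mono mult_right_mono) auto
    also have "\<dots> = real k * (t\<^sup>2 / (2 * (s + t / 3)))"
    proof -
      have "4 * real m * real k * t\<^sup>2 / (8 * real m * c) = real k * (t\<^sup>2 / (2 * c))" for c
        using m by simp
      then show ?thesis .
    qed
    finally show ?thesis by simp
  qed
  finally show ?thesis
    unfolding q_def s_def by (simp add: le_diff_eq)
qed

lemma sigma_star_sq_le:
  "sigma_star_sq m Z X h \<epsilon> \<le> 3 * kernel_var X h / (real m * \<epsilon>\<^sup>2)"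
proof -
  have "(2 * kernel_var X h + 2 * kernel_var1 Z X h) / (real m * \<epsilon>\<^sup>2) \<le> 3 * kernel_var X h / (real m * \<epsilon>\<^sup>2)"
    using kernel_var1_le by (intro divide_right_mono) auto
  then show ?thesis by (simp add: sigma_star_sq_def)
qed

end

theorem proposition4p1:
  fixes P :: "'a measure" and Z :: "'z measure"
    and X :: "nat \<Rightarrow> 'a \<Rightarrow> 'z" and h :: "'z \<times> 'z \<Rightarrow> real"
    and n M :: nat and \<epsilon> :: real
  assumes "prob_space P"
    and "n \<ge> 1" and "M \<ge> 1" and "n \<ge> 2 * M"
    and "prob_space.iid_vars P Z X n"
    and "h \<in> borel_measurable (Z \<Otimes>\<^sub>M Z)"
    and "\<And>x y. x \<in> space Z \<Longrightarrow> y \<in> space Z \<Longrightarrow> h (x, y) = h (y, x)"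
    and "integrable P (\<lambda>\<omega>. (h (X 1 \<omega>, X 2 \<omega>))\<^sup>2)"
    and "\<epsilon> > 0"
  shows "(\<forall>t>0. measure P {\<omega> \<in> space P. prob_space.deviation_freq P n M X h \<epsilon> \<omega>
                                      - prob_space.deviation_mean P n M X h \<epsilon> \<ge> t}
            \<le> exp (- (real n * t\<^sup>2) /
                     (8 * real M * (prob_space.sigma_star_sq P M Z X h \<epsilon> + t / 3))))
       \<and> prob_space.sigma_star_sq P M Z X h \<epsilon>
            \<le> 3 * prob_space.kernel_var P X h / (real M * \<epsilon>\<^sup>2)"
proof -
  interpret prob_space P by fact
  interpret iid_kernel P Z X n h
    by unfold_locales (use assms in auto)
  show ?thesis
    using deviation_freq_tail_le sigma_star_sq_le assms by blast
qed
end
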